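(* Let $m>1$ be an integer, let $\ell$ be an odd integer, and let $K$, $a$, $b$, $c$, $s$ be as defined in the context. We have $$\mathrm{Aut}_2(K)/\mathrm{Inn}(K)\mathrm{Aut}_1(K)\cong Z_2(K)^2/(Z_1(K)\times\langle c\rangle)^2\cong(\mathbb{Z}/2\mathbb{Z})^4.$$ Moreover, $\mathrm{Aut}_2(K)/\mathrm{Inn}(K)\mathrm{Aut}_1(K)$ is generated by the cosets of $\psi_1,\psi_2,\psi_3,\psi_4\in\mathrm{Aut}_2(K)$, where these automorphisms are respectively given by $$a\mapsto a^{1+s},\ b\mapsto b;\qquad a\mapsto a,\ b\mapsto b^{1+s};\qquad a\mapsto ab^s,\ b\mapsto b;\qquad a\mapsto a,\ b\mapsto ba^s.$$
   Context: Notation: $[a,b]=a^{-1}b^{-1}ab$, $b^a=a^{-1}ba$, $\alpha=1+2^m\ell$, $s=2^{m-1}$. Let $$J=\langle A,B\mid A^{[A,B]}=A^{\alpha},\ B^{[B,A]}=B^{\alpha},\ A^{2^{3m-1}}=B^{2^{3m-1}}=1\rangle$$ and $K=J/Z_2(J)$, which has the presentation $$K=\langle a,b\mid a^{[a,b]}=a^{\alpha},\ b^{[b,a]}=b^{\alpha},\ a^{2^{2m-1}}=b^{2^{2m-1}}=[a,b]^{2^{m-1}}=1\rangle,\qquad c=[a,b].$$ For a group $T$, $Z_0(T)=1, Z_1(T),Z_2(T),\dots$ denotes the upper central series, $T^n$ denotes the direct product of $n$ copies of $T$, and $\mathrm{Aut}_i(T)$ is the kernel of the canonical map $\mathrm{Aut}(T)\to\mathrm{Aut}(T/Z_i(T))$.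 It is known that $Z_1(K)=\langle a^{2^m},b^{2^m}\rangle$ and that $Z_2(K)=\langle a^{2^{m-1}},b^{2^{m-1}},c\rangle$ is abelian; $Z_1(K)\times\langle c\rangle$ is an internal direct product inside $Z_2(K)$. For all $x,y\in Z_2(K)$ the assignment $a\mapsto ax$, $b\mapsto by$ extends to an automorphism in $\mathrm{Aut}_2(K)$, so $\psi_1,\dots,\psi_4$ exist. *)

theory Defs
  imports "HOL-Algebra.Algebra"
begin

section \<open>Free groups and presentations\<close>

text \<open>A word over the alphabet \<open>'x\<close> is a list of letters \<open>(e, x)\<close>: the letter \<open>(True, x)\<close> stands
  for \<open>x\<close> and \<open>(False, x)\<close> for its formal inverse. The free group on \<open>'x\<close> consists of the words
  modulo insertion and cancellation of adjacent mutually inverse letters.\<close>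

inductive word_eq :: "(bool \<times> 'x) list \<Rightarrow> (bool \<times> 'x) list \<Rightarrow> bool" where
  cancel: "word_eq (u @ (e, x) # (\<not> e, x) # v) (u @ v)"
| refl: "word_eq u u"
| sym: "word_eq u v \<Longrightarrow> word_eq v u"
| trans: "word_eq u v \<Longrightarrow> word_eq v w \<Longrightarrow> word_eq u w"

definition word_class :: "(bool \<times> 'x) list \<Rightarrow> (bool \<times> 'x) list set" where
  "word_class u = {v. word_eq u v}"

definition free_group :: "(bool \<times> 'x) list set monoid" where
  "free_group = \<lparr>carrier = range word_class,
     monoid.mult = (\<lambda>U V. {w. \<exists>u\<in>U. \<exists>v\<in>V. word_eq (u @ v) w}),
     one = word_class []\<rparr>"

definition free_gen :: "'x \<Rightarrow> (bool \<times> 'x) list set" where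
  "free_gen x = word_class [(True, x)]"

definition normal_closure :: "('a, 'b) monoid_scheme \<Rightarrow> 'a set \<Rightarrow> 'a set" where
  "normal_closure G R = \<Inter>{N. N \<lhd> G \<and> R \<subseteq> N}"

text \<open>\<open>has_presentation G g R\<close>: the group \<open>G\<close> is presented by the generators \<open>g x\<close>, where \<open>x\<close>
  ranges over the type \<open>'x\<close>, and the relators \<open>R\<close>, given as elements of the free group on \<open>'x\<close>.\<close>

definition has_presentation ::
    "('a, 'b) monoid_scheme \<Rightarrow> ('x \<Rightarrow> 'a) \<Rightarrow> (bool \<times> 'x) list set set \<Rightarrow> bool" where
  "has_presentation G g R \<longleftrightarrow> group G \<and>
     (\<exists>\<phi> \<in> iso (free_group Mod normal_closure free_group R) G.
        \<forall>x. \<phi> (normal_closure free_group R #>\<^bsub>free_group\<^esub> free_gen x) = g x)"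


section \<open>Commutators, the upper central series and automorphisms\<close>

definition commutator :: "('a, 'b) monoid_scheme \<Rightarrow> 'a \<Rightarrow> 'a \<Rightarrow> 'a" where
  "commutator G x y = inv\<^bsub>G\<^esub> x \<otimes>\<^bsub>G\<^esub> inv\<^bsub>G\<^esub> y \<otimes>\<^bsub>G\<^esub> x \<otimes>\<^bsub>G\<^esub> y"

definition conjugate :: "('a, 'b) monoid_scheme \<Rightarrow> 'a \<Rightarrow> 'a \<Rightarrow> 'a" where
  "conjugate G x g = inv\<^bsub>G\<^esub> g \<otimes>\<^bsub>G\<^esub> x \<otimes>\<^bsub>G\<^esub> g"

definition group_center :: "('a, 'b) monoid_scheme \<Rightarrow> 'a set" where
  "group_center G = {z \<in> carrier G. \<forall>x\<in>carrier G. z \<otimes>\<^bsub>G\<^esub> x = x \<otimes>\<^bsub>G\<^esub> z}"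

fun upper_central :: "('a, 'b) monoid_scheme \<Rightarrow> nat \<Rightarrow> 'a set" where
  "upper_central G 0 = {\<one>\<^bsub>G\<^esub>}"
| "upper_central G (Suc i) =
     {x \<in> carrier G. upper_central G i #>\<^bsub>G\<^esub> x \<in> group_center (G Mod upper_central G i)}"

definition Inn :: "('a, 'b) monoid_scheme \<Rightarrow> ('a \<Rightarrow> 'a) set" where
  "Inn G = (\<lambda>g. \<lambda>x\<in>carrier G. conjugate G x g) ` carrier G"

text \<open>An automorphism \<open>f\<close> of \<open>G\<close> maps each coset of a characteristic subgroup \<open>Z\<close> onto a coset of
  \<open>Z\<close>; taking images is therefore the canonical map from \<open>Aut(G)\<close> to \<open>Aut(G/Z)\<close>.\<close>

definition Aut_ker :: "nat \<Rightarrow> ('a, 'b) monoid_scheme \<Rightarrow> ('a \<Rightarrow> 'a) set" where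
  "Aut_ker i G =
     kernel (AutoGroup G) (AutoGroup (G Mod upper_central G i))
       (\<lambda>f. \<lambda>C\<in>carrier (G Mod upper_central G i). f ` C)"

abbreviation direct_power :: "('a, 'b) monoid_scheme \<Rightarrow> nat \<Rightarrow> (nat \<Rightarrow> 'a) monoid" where
  "direct_power T n \<equiv> product_group {..<n} (\<lambda>_. T)"


section \<open>The relators of \<open>K\<close>\<close>

datatype gen = GenA | GenB

text \<open>A relation \<open>u = v\<close> is encoded by the relator \<open>u v\<^sup>-\<^sup>1\<close>. The exponent \<open>\<alpha>\<close> is an integer, which is
  negative if \<open>l\<close> is.\<close>

definition K_relators :: "nat \<Rightarrow> int \<Rightarrow> (bool \<times> gen) list set set" where
  "K_relators m l =
     (let F = free_group; A = free_gen GenA; B = free_gen GenB; \<alpha> = 1 + 2 ^ m * l in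
      {conjugate F A (commutator F A B) \<otimes>\<^bsub>F\<^esub> inv\<^bsub>F\<^esub> (A [^]\<^bsub>F\<^esub> \<alpha>),
       conjugate F B (commutator F B A) \<otimes>\<^bsub>F\<^esub> inv\<^bsub>F\<^esub> (B [^]\<^bsub>F\<^esub> \<alpha>),
       A [^]\<^bsub>F\<^esub> (2 ^ (2 * m - 1) :: nat),
       B [^]\<^bsub>F\<^esub> (2 ^ (2 * m - 1) :: nat),
       commutator F A B [^]\<^bsub>F\<^esub> (2 ^ (m - 1) :: nat)})"


section \<open>Every set of relators presents a group\<close>

lemma word_eq_append_left: "word_eq u v \<Longrightarrow> word_eq (w @ u) (w @ v)"
proof (induction rule: word_eq.induct)
  case (cancel u e x v)
  then show ?case using word_eq.cancel[of "w @ u" e x v] by simp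
qed (auto intro: word_eq.intros)

lemma word_eq_append_right: "word_eq u v \<Longrightarrow> word_eq (u @ w) (v @ w)"
proof (induction rule: word_eq.induct)
  case (cancel u e x v)
  then show ?case using word_eq.cancel[of u e x "v @ w"] by simp
qed (auto intro: word_eq.intros)

lemma word_eq_append: "word_eq u u' \<Longrightarrow> word_eq v v' \<Longrightarrow> word_eq (u @ v) (u' @ v')"
  by (meson word_eq.trans word_eq_append_left word_eq_append_right)

lemma word_class_eq_iff: "word_class u = word_class v \<longleftrightarrow> word_eq u v"
  unfolding word_class_def by (auto intro: word_eq.intros)

lemma free_group_mult: "word_class u \<otimes>\<^bsub>free_group\<^esub> word_class v = word_class (u @ v)"
  unfolding word_class_def free_group_def
  by (auto intro: word_eq.intros word_eq_append)

lemma free_group_one: "\<one>\<^bsub>free_group\<^esub> = word_class []"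
  by (simp add: free_group_def)

lemma word_inverse: "word_eq (rev (map (\<lambda>(e, x). (\<not> e, x)) u) @ u) []"
proof (induction u)
  case Nil
  then show ?case by (simp add: word_eq.refl)
next
  case (Cons p u)
  obtain e x where p: "p = (e, x)" by force
  have "word_eq (rev (map (\<lambda>(e, x). (\<not> e, x)) u) @ (\<not> e, x) # (\<not> \<not> e, x) # u)
          (rev (map (\<lambda>(e, x). (\<not> e, x)) u) @ u)"
    by (rule word_eq.cancel)
  then show ?case using Cons p by (auto intro: word_eq.trans)
qed

lemma group_free_group: "group free_group"
proof (rule groupI)
  fix P assume "P \<in> carrier (free_group :: (bool \<times> 'a) list set monoid)"
  then obtain u where "P = word_class u" by (auto simp: free_group_def)
  then show "\<exists>Q\<in>carrier free_group. Q \<otimes>\<^bsub>free_group\<^esub> P = \<one>\<^bsub>free_group\<^esub>"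
  proof (intro bexI[of _ "word_class (rev (map (\<lambda>(e, x). (\<not> e, x)) u))"])
    show "word_class (rev (map (\<lambda>(e, x). (\<not> e, x)) u)) \<otimes>\<^bsub>free_group\<^esub> P = \<one>\<^bsub>free_group\<^esub>"
      unfolding \<open>P = word_class u\<close> free_group_mult free_group_one word_class_eq_iff
      by (rule word_inverse)
  qed (simp add: free_group_def)
next
  fix P assume "P \<in> carrier (free_group :: (bool \<times> 'a) list set monoid)"
  then obtain u where "P = word_class u" by (auto simp: free_group_def)
  then show "\<one>\<^bsub>free_group\<^esub> \<otimes>\<^bsub>free_group\<^esub> P = P"
    by (simp add: free_group_mult free_group_one)
next
  fix P Q :: "(bool \<times> 'a) list set" assume "P \<in> carrier (free_group :: (bool \<times> 'a) list set monoid)" "Q \<in> carrier free_group"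
  then obtain u v where "P = word_class u" "Q = word_class v" by (auto simp: free_group_def)
  then show "P \<otimes>\<^bsub>free_group\<^esub> Q \<in> carrier free_group"
    by (simp add: free_group_mult) (simp add: free_group_def)
next
  fix P Q S :: "(bool \<times> 'a) list set"
  assume "P \<in> carrier (free_group :: (bool \<times> 'a) list set monoid)"
    "Q \<in> carrier free_group" "S \<in> carrier free_group"
  then obtain u v w where "P = word_class u" "Q = word_class v" "S = word_class w"
    by (auto simp: free_group_def)
  then show "P \<otimes>\<^bsub>free_group\<^esub> Q \<otimes>\<^bsub>free_group\<^esub> S = P \<otimes>\<^bsub>free_group\<^esub> (Q \<otimes>\<^bsub>free_group\<^esub> S)"
    by (simp add: free_group_mult)
qed (simp add: free_group_def)

lemma (in group) normal_closure_normal: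
  assumes "R \<subseteq> carrier G" shows "normal_closure G R \<lhd> G"
proof -
  have "carrier G \<in> {N. N \<lhd> G \<and> R \<subseteq> N}"
    using assms normal_self by auto
  then have ne: "{N. N \<lhd> G \<and> R \<subseteq> N} \<noteq> {}" by blast
  have "subgroup (normal_closure G R) G"
    unfolding normal_closure_def
    by (rule subgroups_Inter) (use ne in \<open>auto simp: normal_def\<close>)
  moreover have "x \<otimes> h \<otimes> inv x \<in> normal_closure G R"
    if "x \<in> carrier G" "h \<in> normal_closure G R" for x h
    using that unfolding normal_closure_def by (auto intro: normal.inv_op_closed2)
  ultimately show ?thesis by (simp add: normal_inv_iff)
qed

lemma has_presentation_free_group_Mod:
  assumes "R \<subseteq> carrier free_group"
  shows "has_presentation (free_group Mod normal_closure free_group R)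
           (\<lambda>x. normal_closure free_group R #>\<^bsub>free_group\<^esub> free_gen x) R"
  unfolding has_presentation_def
  using group.normal_closure_normal[OF group_free_group assms] iso_set_refl
  by (auto intro!: normal.factorgroup_is_group bexI[of _ "\<lambda>x. x"])

lemma K_relators_subset: "K_relators m l \<subseteq> carrier free_group"
proof -
  interpret F: group "free_group :: (bool \<times> gen) list set monoid"
    by (rule group_free_group)
  have "free_gen x \<in> carrier free_group" for x :: gen
    by (simp add: free_gen_def free_group_def)
  then show ?thesis
    by (simp add: K_relators_def Let_def conjugate_def commutator_def)
qed

end

theory Submission
  imports Defs
begin

text \<open>
  An automorphism of \<open>K\<close> acts on the abelianization of \<open>K\<close>, which is the square of the cyclic group
  of order \<open>2^m\<close> and has the images of \<open>a\<close> and \<open>b\<close> as a basis. Two descriptions in terms of the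
  abelianization turn the theorem into linear algebra. By \<open>upper_central_2_eq\<close> the second centre is the
  preimage of the vectors divisible by \<open>s = 2^(m-1)\<close>, and by \<open>center_times_c_eq\<close> the product of the centre
  with the powers of \<open>c\<close> is the kernel of the abelianization. Hence the matrix of an automorphism in
  \<open>Aut_2(K)\<close> is \<open>1 + s X\<close> with \<open>X\<close> a two by two matrix over the field with two elements. As \<open>s^2\<close> is
  divisible by \<open>2^m\<close>, sending the automorphism to \<open>X\<close> is a homomorphism (\<open>displacement_hom\<close>) into an
  elementary abelian group of order \<open>16\<close>. The same recipe, applied to a pair of elements of the second
  centre, is a homomorphism onto that group whose kernel consists of the pairs from the kernel of
  the abelianization (\<open>kernel_digits\<close>). It remains to see that the kernel on the side of automorphisms is
  \<open>Inn(K) Aut_1(K)\<close>, and that every \<open>X\<close> occurs.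

  For the kernel (\<open>kernel_displacement\<close>), let \<open>f\<close> be an automorphism with \<open>X = 0\<close>. Up to central factors it
  multiplies \<open>a\<close> by \<open>c^k\<close> and \<open>b\<close> by \<open>c^n\<close>. Modulo its centre \<open>K\<close> has class two, and there conjugation by
  \<open>b^k a^(-n)\<close> does the same; so \<open>f\<close> is an inner automorphism times one that is trivial modulo the
  centre. The four automorphisms of the statement correspond to the four matrix units. They exist
  because the images of \<open>a\<close> and \<open>b\<close> satisfy the defining relations (\<open>Aut2_power\<close> and
  \<open>Aut2_transvection\<close>), and they are bijective because they are onto and \<open>K\<close> is finite.

  For the upper central series, the subgroup generated by \<open>a\<close> and \<open>c\<close> has class two, and
  since conjugation by \<open>b\<close> takes \<open>a\<close> to \<open>a c\<close>, the formula for \<open>(a c)^n\<close> shows that \<open>a^(2^m)\<close> is central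
  and that \<open>a^s\<close> commutes with \<open>b\<close> up to a central factor. Everything then has the form
  \<open>a^i b^j c^k\<close>. That nothing else is central needs a model: by the presentation, \<open>K\<close> acts on the residues
  modulo \<open>2^(2m-1)\<close>, with \<open>b\<close> acting as a translation and \<open>a\<close> as a quadratic polynomial, and a commutator
  condition on \<open>a^i b^j c^k\<close> becomes a difference equation for a quadratic polynomial
  (\<open>commutator_with_b\<close>). The presentation is symmetric in \<open>a\<close> and \<open>b\<close> up to inverting \<open>c\<close>, so this
  action and all other lemmas come together with their mirror images.
\<close>

section \<open>Maps out of a presented group\<close>

definition word_value :: "('a, 'b) monoid_scheme \<Rightarrow> ('x \<Rightarrow> 'a) \<Rightarrow> (bool \<times> 'x) list \<Rightarrow> 'a" where
  "word_value G f w = foldr (\<lambda>(e, x) z. (if e then f x else inv\<^bsub>G\<^esub> f x) \<otimes>\<^bsub>G\<^esub> z) w \<one>\<^bsub>G\<^esub>"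

context group
begin

lemma word_value_closed: "(\<And>x. f x \<in> carrier G) \<Longrightarrow> word_value G f w \<in> carrier G"
  by (induction w) (auto simp: word_value_def)

lemma word_value_append:
  assumes "\<And>x. f x \<in> carrier G"
  shows "word_value G f (u @ v) = word_value G f u \<otimes> word_value G f v"
proof (induction u)
  case Nil
  then show ?case using word_value_closed[of f v, OF assms] by (simp add: word_value_def)
next
  case (Cons p u)
  then show ?case
    using assms word_value_closed[of f v, OF assms] word_value_closed[of f u, OF assms]
    by (cases p) (auto simp: word_value_def m_assoc)
qed

lemma word_value_cong:
  assumes "\<And>x. f x \<in> carrier G" and "word_eq u v"
  shows "word_value G f u = word_value G f v"
  using assms(2)
proof induction
  case (cancel u e x v)
  then have "word_value G f ((e, x) # (\<not> e, x) # v) = word_value G f v"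
    using word_value_closed[of f v, OF assms(1)] unfolding word_value_def
    by (cases e) (simp_all add: assms(1) flip: m_assoc)
  then show ?case by (simp add: word_value_append[of f, OF assms(1)])
qed auto

text \<open>A class is evaluated on a representative; cancelling a letter against its inverse does not
  change the value, so the choice of the representative is immaterial.\<close>

lemma free_group_hom_exists:
  assumes "\<And>x. f x \<in> carrier G"
  obtains h where "h \<in> hom free_group G" "\<And>x. h (free_gen x) = f x"
proof
  let ?h = "\<lambda>U. word_value G f (SOME u. u \<in> U)"
  have *: "?h (word_class u) = word_value G f u" for u
  proof -
    have "u \<in> word_class u" by (simp add: word_class_def word_eq.refl)
    then have "(SOME v. v \<in> word_class u) \<in> word_class u" by (rule someI)
    then show ?thesis using word_value_cong[of f, OF assms] by (simp add: word_class_def)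
  qed
  show "?h \<in> hom free_group G"
  proof (rule homI)
    fix U V :: "(bool \<times> 'c) list set"
    assume "U \<in> carrier free_group" "V \<in> carrier free_group"
    then obtain u v where "U = word_class u" "V = word_class v" by (auto simp: free_group_def)
    then show "?h (U \<otimes>\<^bsub>free_group\<^esub> V) = ?h U \<otimes> ?h V"
      by (simp add: free_group_mult * word_value_append[of f, OF assms])
  qed (use word_value_closed[of f] assms in blast)
  show "?h (free_gen x) = f x" for x
    unfolding free_gen_def * by (simp add: word_value_def assms)
qed

end

lemma free_gen_carrier: "free_gen x \<in> carrier free_group"
  by (simp add: free_gen_def free_group_def)

lemma generate_free_gen:
  "generate free_group (range (free_gen :: 'x \<Rightarrow> _)) = carrier free_group"
proof
  interpret F: group "free_group :: (bool \<times> 'x) list set monoid" by (rule group_free_group)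
  show "generate free_group (range (free_gen :: 'x \<Rightarrow> _)) \<subseteq> carrier free_group"
    by (rule F.generate_incl) (auto simp: free_gen_carrier)
  have letter: "word_class [(e, x)] \<in> generate free_group (range (free_gen :: 'x \<Rightarrow> _))" for e and x :: 'x
  proof (cases e)
    case True
    then show ?thesis by (metis free_gen_def generate.incl rangeI)
  next
    case False
    have "word_eq ([] @ (False, x) # (\<not> False, x) # []) ([] @ [])" by (rule word_eq.cancel)
    then have "word_class [(False, x)] \<otimes>\<^bsub>free_group\<^esub> free_gen x = \<one>\<^bsub>free_group\<^esub>"
      by (simp add: free_gen_def free_group_mult free_group_one word_class_eq_iff)
    then have "inv\<^bsub>free_group\<^esub> free_gen x = word_class [(False, x)]"
      by (intro F.inv_equality free_gen_carrier) (auto simp: free_group_def)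
    then show ?thesis using False by (metis generate.inv rangeI)
  qed
  have "word_class w \<in> generate free_group (range (free_gen :: 'x \<Rightarrow> _))" for w :: "(bool \<times> 'x) list"
  proof (induction w)
    case Nil
    then show ?case by (metis free_group_one generate.one)
  next
    case (Cons p w)
    have "word_class (p # w) = word_class [p] \<otimes>\<^bsub>free_group\<^esub> word_class w"
      by (simp add: free_group_mult)
    then show ?case using Cons letter[of "fst p" "snd p"] by (auto intro: generate.eng)
  qed
  then show "carrier free_group \<subseteq> generate free_group (range (free_gen :: 'x \<Rightarrow> _))"
    by (auto simp: free_group_def)
qed

text \<open>The form in which a presentation is used to compute inside \<open>K\<close>: an epimorphism from the free
  group that kills the relators, so that relations and generation are inherited by \<open>K\<close>.\<close>

lemma presentation_projection:
  fixes R :: "(bool \<times> 'x) list set set"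
  assumes "has_presentation K g R" "R \<subseteq> carrier free_group"
  obtains \<pi> where "\<pi> \<in> hom free_group K" "\<pi> ` carrier free_group = carrier K"
    "\<And>r. r \<in> R \<Longrightarrow> \<pi> r = \<one>\<^bsub>K\<^esub>" "\<And>x. \<pi> (free_gen x) = g x"
proof -
  let ?N = "normal_closure free_group R"
  interpret F: group "free_group :: (bool \<times> 'x) list set monoid" by (rule group_free_group)
  interpret K: group K using assms by (simp add: has_presentation_def)
  interpret N: normal ?N free_group using assms F.normal_closure_normal by blast
  obtain \<phi> where \<phi>: "\<phi> \<in> iso (free_group Mod ?N) K"
    and gen: "\<And>x. \<phi> (?N #>\<^bsub>free_group\<^esub> free_gen x) = g x"
    using assms unfolding has_presentation_def by blast
  let ?\<pi> = "\<phi> \<circ> (\<lambda>u. ?N #>\<^bsub>free_group\<^esub> u)"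
  have q: "(\<lambda>u. ?N #>\<^bsub>free_group\<^esub> u) \<in> hom free_group (free_group Mod ?N)"
    by (rule N.r_coset_hom_Mod)
  show thesis
  proof
    show "?\<pi> \<in> hom free_group K"
      using hom_compose[OF q] \<phi> by (auto simp: iso_def)
    have "(\<lambda>u. ?N #>\<^bsub>free_group\<^esub> u) ` carrier free_group = carrier (free_group Mod ?N)"
      by (auto simp: FactGroup_def RCOSETS_def)
    then show "?\<pi> ` carrier free_group = carrier K"
      using \<phi> by (simp only: image_comp[symmetric] iso_def bij_betw_def mem_Collect_eq)
    show "?\<pi> r = \<one>\<^bsub>K\<^esub>" if "r \<in> R" for r
    proof -
      have "r \<in> ?N" using that by (auto simp: normal_closure_def)
      then have "?N #>\<^bsub>free_group\<^esub> r = \<one>\<^bsub>free_group Mod ?N\<^esub>"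
        by (simp add: FactGroup_def F.coset_join2 N.subgroup_axioms N.subset[THEN subsetD])
      moreover have "\<phi> \<one>\<^bsub>free_group Mod ?N\<^esub> = \<one>\<^bsub>K\<^esub>"
        using \<phi> by (intro hom_one[OF _ N.factorgroup_is_group K.group_axioms]) (auto simp: iso_def)
      ultimately show ?thesis by simp
    qed
    show "?\<pi> (free_gen x) = g x" for x using gen by simp
  qed
qed

text \<open>The universal property of a presentation. The kernel of \<open>h\<close> is a normal subgroup containing
  \<open>R\<close>, so it contains the normal closure of \<open>R\<close>, and \<open>h\<close> factors through the quotient.\<close>

lemma presentation_extend:
  fixes R :: "(bool \<times> 'x) list set set"
  assumes "has_presentation K g R" "R \<subseteq> carrier free_group" "group G"
    and h: "h \<in> hom free_group G" "\<And>r. r \<in> R \<Longrightarrow> h r = \<one>\<^bsub>G\<^esub>"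
  obtains k where "k \<in> hom K G" "\<And>x. k (g x) = h (free_gen x)"
proof -
  let ?N = "normal_closure free_group R"
  interpret F: group "free_group :: (bool \<times> 'x) list set monoid" by (rule group_free_group)
  interpret h: group_hom free_group G h
    by (intro group_hom.intro group_hom_axioms.intro group_free_group assms(3) h(1))
  have N: "?N \<lhd> free_group" using assms F.normal_closure_normal by blast
  obtain \<phi> where \<phi>: "\<phi> \<in> iso (free_group Mod ?N) K"
    and gen: "\<And>x. \<phi> (?N #>\<^bsub>free_group\<^esub> free_gen x) = g x"
    using assms unfolding has_presentation_def by blast
  have "R \<subseteq> kernel free_group G h" using assms(2) h(2) by (auto simp: kernel_def)
  then have "?N \<subseteq> kernel free_group G h"
    using h.normal_kernel by (auto simp: normal_closure_def)
  then obtain k where k: "k \<in> hom (free_group Mod ?N) G"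
    "\<And>u. u \<in> carrier free_group \<Longrightarrow> k (?N #>\<^bsub>free_group\<^esub> u) = h u"
    using h.FactGroup_universal_kernel[OF N] by blast
  have inv: "inv_into (carrier (free_group Mod ?N)) \<phi> \<in> hom K (free_group Mod ?N)"
    using group.iso_set_sym[OF normal.factorgroup_is_group[OF N] \<phi>] by (auto simp: iso_def)
  show thesis
  proof
    show "k \<circ> inv_into (carrier (free_group Mod ?N)) \<phi> \<in> hom K G"
      using hom_compose[OF inv k(1)] .
    fix x
    have "?N #>\<^bsub>free_group\<^esub> free_gen x \<in> carrier (free_group Mod ?N)"
      by (auto simp: FactGroup_def RCOSETS_def free_gen_carrier)
    then have "inv_into (carrier (free_group Mod ?N)) \<phi> (g x) = ?N #>\<^bsub>free_group\<^esub> free_gen x"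
      using \<phi> gen[of x, symmetric] by (auto simp: iso_def bij_betw_def intro!: inv_into_f_eq)
    then show "(k \<circ> inv_into (carrier (free_group Mod ?N)) \<phi>) (g x) = h (free_gen x)"
      by (simp add: k(2) free_gen_carrier)
  qed
qed

text \<open>The relators of \<open>K\<close>, read as equations between two elements of an arbitrary group. They are
  checked for permutations, for elements of a cyclic group, and for the intended images of the
  generators under an automorphism.\<close>

definition macdonald_relations :: "('a, 'b) monoid_scheme \<Rightarrow> nat \<Rightarrow> int \<Rightarrow> 'a \<Rightarrow> 'a \<Rightarrow> bool" where
  "macdonald_relations G m l x y \<longleftrightarrow>
     conjugate G x (commutator G x y) = x [^]\<^bsub>G\<^esub> (1 + 2 ^ m * l) \<and>
     conjugate G y (commutator G y x) = y [^]\<^bsub>G\<^esub> (1 + 2 ^ m * l) \<and>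
     x [^]\<^bsub>G\<^esub> (2 ^ (2 * m - 1) :: nat) = \<one>\<^bsub>G\<^esub> \<and> y [^]\<^bsub>G\<^esub> (2 ^ (2 * m - 1) :: nat) = \<one>\<^bsub>G\<^esub> \<and>
     commutator G x y [^]\<^bsub>G\<^esub> (2 ^ (m - 1) :: nat) = \<one>\<^bsub>G\<^esub>"

context group_hom
begin

lemma hom_commutator:
  "x \<in> carrier G \<Longrightarrow> y \<in> carrier G \<Longrightarrow> h (commutator G x y) = commutator H (h x) (h y)"
  by (simp add: commutator_def)

lemma hom_conjugate:
  "x \<in> carrier G \<Longrightarrow> y \<in> carrier G \<Longrightarrow> h (conjugate G x y) = conjugate H (h x) (h y)"
  by (simp add: conjugate_def)

end

lemma (in group) commutator_closed [simp, intro]: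
  "x \<in> carrier G \<Longrightarrow> y \<in> carrier G \<Longrightarrow> commutator G x y \<in> carrier G"
  by (simp add: commutator_def)

lemma (in group) conjugate_closed [simp, intro]:
  "x \<in> carrier G \<Longrightarrow> y \<in> carrier G \<Longrightarrow> conjugate G x y \<in> carrier G"
  by (simp add: conjugate_def)

lemma (in group) commutator_swap:
  "x \<in> carrier G \<Longrightarrow> y \<in> carrier G \<Longrightarrow> commutator G y x = inv (commutator G x y)"
  by (simp add: commutator_def inv_mult_group m_assoc)

text \<open>Exchanging the generators replaces their commutator by its inverse and exchanges the two
  conjugation relations. This symmetry makes every statement about \<open>a\<close> one about \<open>b\<close>.\<close>

lemma (in group) macdonald_relations_swap:
  assumes "x \<in> carrier G" "y \<in> carrier G"
  shows "macdonald_relations G m l y x \<longleftrightarrow> macdonald_relations G m l x y"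
proof -
  have "commutator G y x [^] (n :: nat) = \<one> \<longleftrightarrow> commutator G x y [^] n = \<one>" for n
    using assms commutator_swap[of x y] by (simp add: nat_pow_inv)
  then show ?thesis by (auto simp: macdonald_relations_def)
qed

text \<open>Conjugation by \<open>[y, x]\<close> is conjugation by the inverse of \<open>d = [x, y]\<close>; all exponents become
  integers, so that one set of power laws serves throughout.\<close>

lemma (in group) macdonald_relations_iff:
  assumes "x \<in> carrier G" "y \<in> carrier G"
  defines "d \<equiv> commutator G x y"
  shows "macdonald_relations G m l x y \<longleftrightarrow>
    inv d \<otimes> x \<otimes> d = x [^] (1 + 2 ^ m * l) \<and> d \<otimes> y \<otimes> inv d = y [^] (1 + 2 ^ m * l) \<and>
    x [^] (2 ^ (2 * m - 1) :: int) = \<one> \<and> y [^] (2 ^ (2 * m - 1) :: int) = \<one> \<and>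
    d [^] (2 ^ (m - 1) :: int) = \<one>"
proof -
  have pow: "u [^] (2 ^ k :: int) = u [^] (2 ^ k :: nat)" for u k
    using int_pow_int[of G u "2 ^ k"] by simp
  show ?thesis
    using assms(1,2) commutator_swap[OF assms(1,2)]
    by (simp only: macdonald_relations_def conjugate_def d_def pow inv_inv commutator_closed)
qed

lemma K_relators_killed_iff:
  assumes "group G" "h \<in> hom free_group G"
  shows "(\<forall>r\<in>K_relators m l. h r = \<one>\<^bsub>G\<^esub>) \<longleftrightarrow>
    macdonald_relations G m l (h (free_gen GenA)) (h (free_gen GenB))"
proof -
  interpret F: group "free_group :: (bool \<times> gen) list set monoid" by (rule group_free_group)
  interpret h: group_hom free_group G h
    by (intro group_hom.intro group_hom_axioms.intro group_free_group assms)
  have *: "x \<otimes>\<^bsub>G\<^esub> inv\<^bsub>G\<^esub> y = \<one>\<^bsub>G\<^esub> \<longleftrightarrow> x = y" if "x \<in> carrier G" "y \<in> carrier G" for x y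
    using that h.H.inv_solve_right'[of "\<one>\<^bsub>G\<^esub>" x y] by auto
  show ?thesis
    by (simp add: K_relators_def Let_def macdonald_relations_def free_gen_carrier
        h.hom_conjugate h.hom_commutator h.hom_int_pow h.hom_nat_pow * )
qed

lemma K_extend:
  assumes "has_presentation K (case_gen a b) (K_relators m l)"
    and "group G" "x \<in> carrier G" "y \<in> carrier G" "macdonald_relations G m l x y"
  shows "\<exists>k\<in>hom K G. k a = x \<and> k b = y"
proof -
  have "\<And>u. case_gen x y u \<in> carrier G" using assms(3,4) by (simp split: gen.split)
  then obtain h where h: "h \<in> hom free_group G" "\<And>u. h (free_gen u) = case_gen x y u"
    using group.free_group_hom_exists[OF assms(2)] by metis
  have "\<And>r. r \<in> K_relators m l \<Longrightarrow> h r = \<one>\<^bsub>G\<^esub>"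
    using K_relators_killed_iff[OF assms(2) h(1), of m l] h(2) assms(5) by simp
  from presentation_extend[OF assms(1) K_relators_subset assms(2) h(1) this]
  obtain k where k: "k \<in> hom K G" "\<And>u. k (case_gen a b u) = h (free_gen u)" by metis
  show ?thesis
    using k(1) k(2)[of GenA] k(2)[of GenB] h(2) by auto
qed

lemma K_generated:
  assumes "has_presentation K (case_gen a b) (K_relators m l)"
  shows "a \<in> carrier K" "b \<in> carrier K" "macdonald_relations K m l a b"
    "generate K {a, b} = carrier K"
proof -
  interpret F: group "free_group :: (bool \<times> gen) list set monoid" by (rule group_free_group)
  obtain \<pi> where \<pi>: "\<pi> \<in> hom free_group K" "\<pi> ` carrier free_group = carrier K"
    "\<And>r. r \<in> K_relators m l \<Longrightarrow> \<pi> r = \<one>\<^bsub>K\<^esub>" "\<And>x. \<pi> (free_gen x) = case_gen a b x"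
    using presentation_projection[OF assms K_relators_subset] by metis
  have gK: "group K" using assms by (simp add: has_presentation_def)
  interpret \<pi>: group_hom free_group K \<pi>
    by (intro group_hom.intro group_hom_axioms.intro group_free_group gK \<pi>(1))
  have ab: "\<pi> (free_gen GenA) = a" "\<pi> (free_gen GenB) = b" by (simp_all add: \<pi>(4))
  show "a \<in> carrier K" "b \<in> carrier K" using ab by (metis \<pi>.hom_closed free_gen_carrier)+
  show "macdonald_relations K m l a b"
    using K_relators_killed_iff[OF gK \<pi>(1), of m l] \<pi>(3) ab by metis
  have "\<pi> ` range free_gen = {a, b}"
    using ab gen.exhaust by (fastforce simp: image_iff \<pi>(4) split: gen.splits)
  then show "generate K {a, b} = carrier K"
    using \<pi>.generate_img[of "range free_gen"] \<pi>(2)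
    by (simp add: generate_free_gen free_gen_carrier image_subset_iff)
qed

section \<open>Powers in groups of class two\<close>

definition triangular :: "int \<Rightarrow> int" where
  "triangular n = n * (n - 1) div 2"

lemma two_triangular: "2 * triangular n = n * (n - 1)"
  by (simp add: triangular_def)

lemma triangular_step: "triangular (n + 1) = triangular n + n"
  using two_triangular[of n] two_triangular[of "n + 1"] by (simp add: algebra_simps)

context group
begin

text \<open>A two-sided sequence that passes through \<open>\<one>\<close> and grows by the factor \<open>g\<close> consists of the
  powers of \<open>g\<close>. This spares later proofs the induction in both directions.\<close>

lemma eq_int_powI:
  assumes "g \<in> carrier G" "\<And>n. f n \<in> carrier G" "f 0 = \<one>" "\<And>n. f (n + 1) = f n \<otimes> g"
  shows "f n = g [^] (n :: int)"
proof (induction n rule: int_induct[where k = 0])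
  case base
  then show ?case by (simp add: assms)
next
  case (step1 i)
  then show ?case by (simp add: assms int_pow_mult)
next
  case (step2 i)
  have "f (i - 1) \<otimes> g = g [^] (i - 1) \<otimes> g"
    using step2 assms(4)[of "i - 1"] int_pow_mult[of g "i - 1" 1] assms(1) by simp
  then show ?case using assms(1,2) by simp
qed

lemma cancel_inv [simp]:
  assumes "x \<in> carrier G" "y \<in> carrier G"
  shows "x \<otimes> (inv x \<otimes> y) = y" "inv x \<otimes> (x \<otimes> y) = y"
  using assms by (simp_all flip: m_assoc)

lemma conj_eq_iff:
  assumes "x \<in> carrier G" "y \<in> carrier G" "w \<in> carrier G"
  shows "inv y \<otimes> x \<otimes> y = w \<longleftrightarrow> x \<otimes> y = y \<otimes> w"
  using assms inv_solve_left'[of w y "x \<otimes> y"] by (simp add: m_assoc)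

lemma int_pow_conj:
  assumes "x \<in> carrier G" "y \<in> carrier G"
  shows "(inv y \<otimes> x \<otimes> y) [^] (i :: int) = inv y \<otimes> x [^] i \<otimes> y"
proof (rule eq_int_powI[symmetric])
  fix n :: int
  show "inv y \<otimes> x [^] (n + 1) \<otimes> y = inv y \<otimes> x [^] n \<otimes> y \<otimes> (inv y \<otimes> x \<otimes> y)"
    using assms by (simp add: int_pow_mult m_assoc)
qed (use assms in auto)

lemma int_pow_commute:
  assumes "x \<in> carrier G" "y \<in> carrier G" "x \<otimes> y = y \<otimes> x"
  shows "x [^] (i :: int) \<otimes> y = y \<otimes> x [^] i"
proof -
  have "inv y \<otimes> x \<otimes> y = x" using assms by (simp add: conj_eq_iff)
  then have "inv y \<otimes> x [^] i \<otimes> y = x [^] i" using int_pow_conj[of x y i] assms by simp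
  then show ?thesis using assms by (simp add: conj_eq_iff)
qed

text \<open>Conjugation by \<open>y\<close> multiplies \<open>x\<close> by a power of \<open>z\<close> and hence takes \<open>x [^] i\<close> to
  \<open>x [^] i \<otimes> z [^] (- i)\<close>; reading this as a conjugation of \<open>y\<close> by \<open>x [^] i\<close> and taking
  powers again yields the bilinear exponent \<open>i * k\<close>.\<close>

lemma class2_swap:
  assumes xyz: "x \<in> carrier G" "y \<in> carrier G" "z \<in> carrier G"
    and "y \<otimes> x = x \<otimes> y \<otimes> z" "z \<otimes> x = x \<otimes> z" "z \<otimes> y = y \<otimes> z"
  shows "y [^] (k :: int) \<otimes> x [^] (i :: int) = x [^] i \<otimes> y [^] k \<otimes> z [^] (i * k)"
proof -
  have zx: "inv z \<otimes> x = x \<otimes> inv z" "inv z \<otimes> y = y \<otimes> inv z"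
    using assms(5,6) xyz int_pow_commute[of z x "-1"] int_pow_commute[of z y "-1"]
    by (simp_all add: int_pow_neg)
  have "y \<otimes> (x \<otimes> inv z) = x \<otimes> y \<otimes> z \<otimes> inv z" using xyz assms(4) by (simp flip: m_assoc)
  then have "x \<otimes> y = y \<otimes> (x \<otimes> inv z)" using xyz by (simp add: m_assoc)
  then have 1: "inv y \<otimes> x \<otimes> y = x \<otimes> inv z" using xyz by (subst conj_eq_iff) simp_all
  have 2: "inv y \<otimes> x [^] i \<otimes> y = x [^] i \<otimes> z [^] (- i)"
    using int_pow_conj[of x y i] int_pow_mult_distrib[of x "inv z" i] zx xyz 1
    by (simp add: int_pow_inv int_pow_neg)
  have zxi: "z [^] j \<otimes> x [^] i = x [^] i \<otimes> z [^] j" for j :: int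
    using int_pow_commute[of x "z [^] j" i] int_pow_commute[of z x j] assms by simp
  have 3: "inv (x [^] i) \<otimes> y \<otimes> x [^] i = y \<otimes> z [^] i"
  proof -
    have "x [^] i \<otimes> y = y \<otimes> (x [^] i \<otimes> z [^] (- i))"
      using arg_cong[OF 2, of "\<lambda>u. y \<otimes> u"] xyz by (simp flip: m_assoc)
    then have "x [^] i \<otimes> y \<otimes> z [^] i = y \<otimes> x [^] i"
      using xyz by (simp add: m_assoc flip: int_pow_mult)
    then have "y \<otimes> x [^] i = x [^] i \<otimes> (y \<otimes> z [^] i)" using xyz by (simp add: m_assoc)
    then show ?thesis using xyz by (subst conj_eq_iff) simp_all
  qed
  have "y \<otimes> z [^] i = z [^] i \<otimes> y" using int_pow_commute[of z y i] assms by simp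
  then have "inv (x [^] i) \<otimes> y [^] k \<otimes> x [^] i = y [^] k \<otimes> z [^] (i * k)"
    using int_pow_conj[of y "x [^] i" k] int_pow_mult_distrib[of y "z [^] i" k] xyz
    by (simp only: 3 int_pow_closed int_pow_pow)
  then have "y [^] k \<otimes> x [^] i = x [^] i \<otimes> (y [^] k \<otimes> z [^] (i * k))"
    using xyz by (simp add: conj_eq_iff)
  then show ?thesis using xyz by (simp add: m_assoc)
qed

text \<open>Collecting the factors of \<open>(x \<otimes> y)\<close> from left to right, the next \<open>x\<close> passes \<open>y [^] n\<close>
  and leaves \<open>z [^] n\<close> behind; the exponents \<open>0, 1, 2, \<dots>\<close> add up to a triangular number.\<close>

lemma class2_power:
  assumes xyz: "x \<in> carrier G" "y \<in> carrier G" "z \<in> carrier G"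
    and rel: "y \<otimes> x = x \<otimes> y \<otimes> z" "z \<otimes> x = x \<otimes> z" "z \<otimes> y = y \<otimes> z"
  shows "(x \<otimes> y) [^] (n :: int) = x [^] n \<otimes> y [^] n \<otimes> z [^] triangular n"
proof (rule eq_int_powI[symmetric])
  show "x [^] (0::int) \<otimes> y [^] (0::int) \<otimes> z [^] triangular 0 = \<one>"
    by (simp add: triangular_def)
  fix n :: int
  have zx: "z [^] j \<otimes> x = x \<otimes> z [^] j" "z [^] j \<otimes> y = y \<otimes> z [^] j" for j :: int
    by (rule int_pow_commute; use xyz rel in blast)+
  have yx: "y [^] n \<otimes> x = x \<otimes> y [^] n \<otimes> z [^] n"
    using class2_swap[OF xyz rel, of n 1] xyz(1) by simp
  have *: "y [^] n \<otimes> (x \<otimes> w) = x \<otimes> (y [^] n \<otimes> (z [^] n \<otimes> w))" if "w \<in> carrier G" for w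
    using that xyz arg_cong[OF yx, of "\<lambda>u. u \<otimes> w"] by (simp add: m_assoc)
  have "x [^] n \<otimes> y [^] n \<otimes> z [^] triangular n \<otimes> (x \<otimes> y)
     = x [^] n \<otimes> (y [^] n \<otimes> (z [^] triangular n \<otimes> x \<otimes> y))"
    using xyz by (simp add: m_assoc)
  also have "\<dots> = x [^] n \<otimes> (y [^] n \<otimes> (x \<otimes> (z [^] triangular n \<otimes> y)))"
    using xyz by (simp add: zx m_assoc)
  also have "\<dots> = x [^] n \<otimes> (x \<otimes> (y [^] n \<otimes> (z [^] n \<otimes> (z [^] triangular n \<otimes> y))))"
    using xyz by (simp add: * )
  also have "\<dots> = x [^] n \<otimes> (x \<otimes> (y [^] n \<otimes> (z [^] (triangular n + n) \<otimes> y)))"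
    using xyz int_pow_mult[of z n "triangular n"] by (simp add: m_assoc add.commute)
  also have "\<dots> = x [^] (n + 1) \<otimes> y [^] (n + 1) \<otimes> z [^] triangular (n + 1)"
    using xyz int_pow_mult[of x n 1] int_pow_mult[of y n 1]
    by (simp add: zx m_assoc triangular_step)
  finally show "x [^] (n + 1) \<otimes> y [^] (n + 1) \<otimes> z [^] triangular (n + 1)
     = x [^] n \<otimes> y [^] n \<otimes> z [^] triangular n \<otimes> (x \<otimes> y)" by simp
qed (use xyz in auto)

lemma group_centerD: "z \<in> group_center G \<Longrightarrow> z \<in> carrier G"
  "z \<in> group_center G \<Longrightarrow> x \<in> carrier G \<Longrightarrow> z \<otimes> x = x \<otimes> z"
  by (auto simp: group_center_def)

lemma subgroup_group_center: "subgroup (group_center G) G"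
proof (rule subgroupI)
  fix z w assume z: "z \<in> group_center G" and w: "w \<in> group_center G"
  note carr = group_centerD(1)[OF z] group_centerD(1)[OF w]
  have "z \<otimes> w \<otimes> x = x \<otimes> (z \<otimes> w)" if x: "x \<in> carrier G" for x
  proof -
    have "z \<otimes> w \<otimes> x = z \<otimes> x \<otimes> w"
      using carr x group_centerD(2)[OF w x] by (simp add: m_assoc)
    then show ?thesis using carr x group_centerD(2)[OF z x] by (simp add: m_assoc)
  qed
  then show "z \<otimes> w \<in> group_center G" using carr by (simp add: group_center_def)
  have "inv z \<otimes> x = x \<otimes> inv z" if x: "x \<in> carrier G" for x
    using int_pow_commute[OF carr(1) x group_centerD(2)[OF z x], of "-1"] carr by (simp add: int_pow_neg)
  then show "inv z \<in> group_center G" using carr by (simp add: group_center_def)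
qed (auto simp: group_center_def intro: exI[of _ \<one>])

end


section \<open>Commutation rules and normal form in \<open>K\<close>\<close>

text \<open>The properties of the presentation that the proof uses, in a form that is symmetric in \<open>a\<close>
  and \<open>b\<close>. The universal property occurs once for each type of target group: endomorphisms of \<open>K\<close>,
  groups of permutations of integers, and groups of residues.\<close>

locale macdonald_quotient = group K for K :: "('k, 'e) monoid_scheme" (structure) +
  fixes m :: nat and l :: int and a b :: 'k
  assumes m: "m > 1" and l: "odd l"
    and a [simp, intro]: "a \<in> carrier K" and b [simp, intro]: "b \<in> carrier K"
    and relations: "macdonald_relations K m l a b"
    and generated: "generate K {a, b} = carrier K"
    and endomorphism: "\<And>x y. x \<in> carrier K \<Longrightarrow> y \<in> carrier K \<Longrightarrow> macdonald_relations K m l x y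
      \<Longrightarrow> \<exists>f\<in>hom K K. f a = x \<and> f b = y"
    and representation: "\<And>(G :: (int \<Rightarrow> int) monoid) x y. group G \<Longrightarrow> x \<in> carrier G \<Longrightarrow> y \<in> carrier G
      \<Longrightarrow> macdonald_relations G m l x y \<Longrightarrow> \<exists>f\<in>hom K G. f a = x \<and> f b = y"
    and character: "\<And>(G :: int monoid) x y. group G \<Longrightarrow> x \<in> carrier G \<Longrightarrow> y \<in> carrier G
      \<Longrightarrow> macdonald_relations G m l x y \<Longrightarrow> \<exists>f\<in>hom K G. f a = x \<and> f b = y"
begin

text \<open>Opaque names for \<open>2^m\<close>, \<open>2^(m-1)\<close> and \<open>2^(2m-1)\<close>: almost all of the arithmetic below uses only
  that \<open>M = 2 * S\<close>, that \<open>N = M * S\<close> and that \<open>S\<close> is even.\<close>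

definition "M = (2 :: int) ^ m"
definition "S = (2 :: int) ^ (m - 1)"
definition "N = (2 :: int) ^ (2 * m - 1)"

abbreviation "c \<equiv> commutator K a b"

lemma M_eq: "M = 2 * S"
  using m by (simp add: M_def S_def flip: power_Suc)

lemma N_eq: "N = M * S"
  using m by (simp add: M_def S_def N_def mult_2 flip: power_add)

lemma even_S: "2 dvd S"
  using m by (simp add: S_def dvd_power)

text \<open>Every lemma of this locale holds with \<open>a\<close> and \<open>b\<close> exchanged, \<open>c\<close> then being replaced by its
  inverse.\<close>

lemma mirror: "macdonald_quotient K m l b a"
proof (rule macdonald_quotient.intro[OF group_axioms], rule macdonald_quotient_axioms.intro)
  show "macdonald_relations K m l b a" using relations macdonald_relations_swap by simp
  show "generate K {b, a} = carrier K" using generated by (simp add: insert_commute)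
next
  fix x y
  assume "x \<in> carrier K" "y \<in> carrier K" "macdonald_relations K m l x y"
  then show "\<exists>f\<in>hom K K. f b = x \<and> f a = y"
    using endomorphism[of y x] macdonald_relations_swap[of x y m l] by blast
next
  fix G :: "(int \<Rightarrow> int) monoid" and x y
  assume "group G" "x \<in> carrier G" "y \<in> carrier G" "macdonald_relations G m l x y"
  then show "\<exists>f\<in>hom K G. f b = x \<and> f a = y"
    using representation[of G y x] group.macdonald_relations_swap[of G x y m l] by blast
next
  fix G :: "int monoid" and x y
  assume "group G" "x \<in> carrier G" "y \<in> carrier G" "macdonald_relations G m l x y"
  then show "\<exists>f\<in>hom K G. f b = x \<and> f a = y"
    using character[of G y x] group.macdonald_relations_swap[of G x y m l] by blast
qed (rule m l a b)+

lemma c_mirror: "commutator K b a = inv c"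
  by (rule commutator_swap[OF a b])

lemma a_order: "a [^] N = \<one>"
  using relations by (simp add: macdonald_relations_iff N_def)

lemma c_order: "c [^] S = \<one>"
  using relations by (simp add: macdonald_relations_iff S_def)

lemma a_pow_dvd: "N dvd i \<Longrightarrow> a [^] i = \<one>"
  using int_pow_pow[of a "N"] a_order by (auto elim!: dvdE)

lemma c_pow_dvd: "S dvd i \<Longrightarrow> c [^] i = \<one>"
  using int_pow_pow[of c "S"] c_order by (auto elim!: dvdE)

lemma a_pow_cong: "N dvd i - j \<Longrightarrow> a [^] i = a [^] j"
  using a_pow_dvd[of "i - j"] int_pow_mult[of a "i - j" j] by simp

text \<open>Since the generators have finite order, their inverses are positive powers, and closure under
  right multiplication by \<open>a\<close> and \<open>b\<close> is enough.\<close>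

lemma generator_induct [consumes 1, case_names one a b]:
  assumes "g \<in> carrier K" "P \<one>" "\<And>x. x \<in> carrier K \<Longrightarrow> P x \<Longrightarrow> P (x \<otimes> a)"
    "\<And>x. x \<in> carrier K \<Longrightarrow> P x \<Longrightarrow> P (x \<otimes> b)"
  shows "P g"
proof -
  have pow: "P (x \<otimes> u [^] (n :: nat))" if "u \<in> {a, b}" "x \<in> carrier K" "P x" for u x n
  proof (induction n)
    case 0
    then show ?case using that by simp
  next
    case (Suc n)
    have "x \<otimes> u [^] Suc n = x \<otimes> u [^] n \<otimes> u" using that by (auto simp: m_assoc)
    then show ?case using Suc that assms by auto
  qed
  have invu: "inv u = u [^] (2 ^ (2 * m - 1) - 1 :: nat)" if "u \<in> {a, b}" for u
  proof (rule inv_equality)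
    have "u [^] (2 ^ (2 * m - 1) - 1 :: nat) \<otimes> u = u [^] Suc (2 ^ (2 * m - 1) - 1)"
      by (rule nat_pow_Suc[symmetric])
    also have "Suc (2 ^ (2 * m - 1) - 1) = 2 ^ (2 * m - 1)" by simp
    finally show "u [^] (2 ^ (2 * m - 1) - 1 :: nat) \<otimes> u = \<one>"
      using that relations by (auto simp: macdonald_relations_def)
  qed (use that in auto)
  have "\<forall>x\<in>carrier K. P x \<longrightarrow> P (x \<otimes> g)" if "g \<in> generate K {a, b}" for g
    using that
  proof induction
    case (inv h)
    then show ?case using pow invu by metis
  next
    case (eng h1 h2)
    then have "h1 \<in> carrier K" "h2 \<in> carrier K" using generated by auto
    then show ?case using eng by (auto simp flip: m_assoc)
  qed (use assms in auto)
  then show ?thesis using assms(1,2) generated by force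
qed

lemma group_centerI:
  assumes "z \<in> carrier K" "z \<otimes> a = a \<otimes> z" "z \<otimes> b = b \<otimes> z"
  shows "z \<in> group_center K"
proof -
  have "z \<otimes> x = x \<otimes> z" if "x \<in> carrier K" for x
    using that
  proof (induction rule: generator_induct)
    case (a x)
    then have "z \<otimes> (x \<otimes> a) = x \<otimes> z \<otimes> a" using assms(1) by (simp flip: m_assoc)
    then show ?case using assms(1,2) a by (simp add: m_assoc)
  next
    case (b x)
    then have "z \<otimes> (x \<otimes> b) = x \<otimes> z \<otimes> b" using assms(1) by (simp flip: m_assoc)
    then show ?case using assms(1,3) b by (simp add: m_assoc)
  qed (use assms in auto)
  then show ?thesis using assms by (simp add: group_center_def)
qed

lemma conj_c_a_pow: "inv c \<otimes> a [^] i \<otimes> c = a [^] ((1 + M * l) * i)"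
  using relations int_pow_conj[of a c i]
  by (simp add: macdonald_relations_iff int_pow_pow M_def)

text \<open>Conjugation by \<open>c\<close> raises to the power \<open>1 + M * l\<close>, which changes an exponent divisible by
  \<open>M\<close> by a multiple of \<open>M * M\<close>, hence of \<open>N\<close>.\<close>

lemma a_pow_M_commute_c: "a [^] (M * t) \<otimes> c = c \<otimes> a [^] (M * t)"
proof -
  have "(1 + M * l) * (M * t) - M * t = M * M * (l * t)" by (simp only: ring_distribs mult_ac add_diff_cancel_left' mult_1)
  then have "N dvd (1 + M * l) * (M * t) - M * t"
    by (simp add: N_eq M_eq)
  then have "inv c \<otimes> a [^] (M * t) \<otimes> c = a [^] (M * t)"
    unfolding conj_c_a_pow by (rule a_pow_cong)
  then show ?thesis by (simp add: conj_eq_iff)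
qed

text \<open>By the preceding lemma the subgroup generated by \<open>a\<close> and \<open>c\<close> has class two, with commutator a
  power of \<open>a [^] M\<close>. The general rules for such groups apply.\<close>

lemma c_a: "c \<otimes> a = a \<otimes> c \<otimes> a [^] (M * - l)"
proof -
  have "a \<otimes> c = c \<otimes> a [^] (1 + M * l)"
    using conj_c_a_pow[of 1] by (simp add: conj_eq_iff)
  then have "a \<otimes> c \<otimes> a [^] (M * - l) = c \<otimes> (a [^] (1 + M * l) \<otimes> a [^] (M * - l))"
    by (simp add: m_assoc)
  then show ?thesis by (simp flip: int_pow_mult)
qed

lemma a_pow_commute_a: "a [^] i \<otimes> a = a \<otimes> a [^] (i :: int)"
  by (simp add: int_pow_commute)

lemma c_pow_a_pow: "c [^] k \<otimes> a [^] i = a [^] i \<otimes> c [^] k \<otimes> a [^] (- M * l * i * k)"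
proof -
  have "c [^] k \<otimes> a [^] i = a [^] i \<otimes> c [^] k \<otimes> (a [^] (M * - l)) [^] (i * k)"
    by (rule class2_swap) (use c_a a_pow_M_commute_c[of "- l"] a_pow_commute_a in auto)
  then show ?thesis by (simp add: int_pow_pow mult.assoc)
qed

text \<open>The definition of \<open>c\<close> says that conjugation by \<open>b\<close> takes \<open>a\<close> to \<open>a \<otimes> c\<close>, and the \<open>n\<close>-th
  power of this product is known in a group of class two.\<close>

lemma conj_b_a_pow: "inv b \<otimes> a [^] n \<otimes> b = a [^] n \<otimes> c [^] n \<otimes> a [^] (- M * l * triangular n)"
proof -
  have "inv b \<otimes> a \<otimes> b = a \<otimes> c" by (simp add: commutator_def flip: m_assoc)
  then have "inv b \<otimes> a [^] n \<otimes> b = (a \<otimes> c) [^] n" by (simp flip: int_pow_conj)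
  also have "\<dots> = a [^] n \<otimes> c [^] n \<otimes> (a [^] (M * - l)) [^] triangular n"
    by (rule class2_power) (use c_a a_pow_M_commute_c[of "- l"] a_pow_commute_a in auto)
  finally show ?thesis by (simp add: int_pow_pow)
qed

text \<open>In the formula for the conjugate of \<open>a [^] n\<close> by \<open>b\<close>, the powers of \<open>c\<close> and of \<open>a [^] M\<close> both
  vanish for \<open>n = M * t\<close>, the latter because \<open>triangular (M * t)\<close> is a multiple of \<open>S\<close>.\<close>

lemma a_pow_M_central: "a [^] (M * t) \<in> group_center K"
proof (rule group_centerI)
  have "2 * triangular (M * t) = 2 * (S * (t * (M * t - 1)))"
    by (simp add: two_triangular M_eq)
  then have "triangular (M * t) = S * (t * (M * t - 1))" by simp
  then have "a [^] (- M * l * triangular (M * t)) = \<one>"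
    by (intro a_pow_dvd) (simp add: N_eq mult.left_commute)
  moreover have "c [^] (M * t) = \<one>" by (intro c_pow_dvd) (simp add: M_eq)
  ultimately have "inv b \<otimes> a [^] (M * t) \<otimes> b = a [^] (M * t)" using conj_b_a_pow[of "M * t"] by simp
  then show "a [^] (M * t) \<otimes> b = b \<otimes> a [^] (M * t)"
    by (simp add: conj_eq_iff)
qed (use a_pow_commute_a in auto)

lemma a_pow_M_commute: "x \<in> carrier K \<Longrightarrow> a [^] (M * t) \<otimes> x = x \<otimes> a [^] (M * t)"
  using a_pow_M_central by (rule group_centerD)

lemmas b_pow_M_central = macdonald_quotient.a_pow_M_central[OF mirror]
lemmas b_pow_M_commute = macdonald_quotient.a_pow_M_commute[OF mirror]
lemmas b_pow_dvd = macdonald_quotient.a_pow_dvd[OF mirror]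
lemmas b_pow_cong = macdonald_quotient.a_pow_cong[OF mirror]

lemma c_pow_b_pow: "c [^] k \<otimes> b [^] i = b [^] i \<otimes> c [^] k \<otimes> b [^] (M * l * i * k)"
  using macdonald_quotient.c_pow_a_pow[OF mirror, of "- k" i]
  by (simp add: c_mirror int_pow_inv int_pow_neg)

lemma conj_a_b_pow: "inv a \<otimes> b [^] n \<otimes> a = b [^] n \<otimes> c [^] (- n) \<otimes> b [^] (- M * l * triangular n)"
  using macdonald_quotient.conj_b_a_pow[OF mirror, of n]
  by (simp add: c_mirror int_pow_inv int_pow_neg)

text \<open>The products of this shape are closed under right multiplication by \<open>a\<close> and by \<open>b\<close>: moving the
  new letter to its place creates powers of \<open>c\<close> and central powers of \<open>a\<close> and \<open>b\<close> only.\<close>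

lemma normal_form:
  assumes "g \<in> carrier K"
  obtains i j k :: int where "g = a [^] i \<otimes> b [^] j \<otimes> c [^] k"
proof -
  have "\<exists>i j k. g = a [^] (i :: int) \<otimes> b [^] (j :: int) \<otimes> c [^] (k :: int)"
    using assms
  proof (induction rule: generator_induct)
    case one
    then show ?case by (intro exI[of _ 0]) simp
  next
    case (a x)
    then obtain i j k where x: "x = a [^] (i :: int) \<otimes> b [^] (j :: int) \<otimes> c [^] (k :: int)" by blast
    define p q where "p = - l * k" and "q = - l * triangular j"
    define u v where "u = a [^] (M * p)" and "v = b [^] (M * q)"
    have u: "u \<in> carrier K" "\<And>x. x \<in> carrier K \<Longrightarrow> x \<otimes> u = u \<otimes> x"
      by (simp_all add: u_def a_pow_M_commute)
    have v: "v \<in> carrier K" "\<And>x. x \<in> carrier K \<Longrightarrow> x \<otimes> v = v \<otimes> x"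
      by (simp_all add: v_def b_pow_M_commute)
    have 1: "c [^] k \<otimes> a = a \<otimes> c [^] k \<otimes> u"
      using c_pow_a_pow[of k 1] by (simp add: u_def p_def mult.assoc)
    have "b [^] j \<otimes> a = a \<otimes> (b [^] j \<otimes> c [^] (- j) \<otimes> v)"
      using conj_a_b_pow[of j] by (simp add: v_def q_def mult.assoc conj_eq_iff)
    then have "b [^] j \<otimes> a = a \<otimes> (b [^] j \<otimes> (v \<otimes> c [^] (- j)))"
      using v(1) v(2)[of "c [^] (- j)"] by (simp add: m_assoc)
    then have 2: "b [^] j \<otimes> (a \<otimes> w) = a \<otimes> (b [^] j \<otimes> (v \<otimes> (c [^] (- j) \<otimes> w)))"
      if "w \<in> carrier K" for w
      using that v(1) by (simp flip: m_assoc)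
    have "x \<otimes> a = a [^] i \<otimes> (b [^] j \<otimes> (a \<otimes> (c [^] k \<otimes> u)))"
      using u(1) by (simp add: x m_assoc 1)
    also have "\<dots> = a [^] i \<otimes> (a \<otimes> (b [^] j \<otimes> (v \<otimes> (c [^] (- j) \<otimes> (c [^] k \<otimes> u)))))"
      using u(1) v(1) by (simp add: 2)
    also have "\<dots> = (a [^] i \<otimes> (a \<otimes> (b [^] j \<otimes> (v \<otimes> (c [^] (- j) \<otimes> c [^] k))))) \<otimes> u"
      using u(1) v(1) by (simp add: m_assoc)
    also have "\<dots> = u \<otimes> (a [^] i \<otimes> (a \<otimes> (b [^] j \<otimes> (v \<otimes> (c [^] (- j) \<otimes> c [^] k)))))"
      using v(1) by (intro u(2)) simp
    also have "\<dots> = a [^] (M * p + i + 1) \<otimes> b [^] (j + M * q) \<otimes> c [^] (- j + k)"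
      using int_pow_mult[of c "- j" k] by (simp add: u_def v_def int_pow_mult m_assoc)
    finally show ?case by blast
  next
    case (b x)
    then obtain i j k where x: "x = a [^] (i :: int) \<otimes> b [^] (j :: int) \<otimes> c [^] (k :: int)" by blast
    have "c [^] k \<otimes> b = b \<otimes> c [^] k \<otimes> b [^] (M * (l * k))"
      using c_pow_b_pow[of k 1] by (simp add: mult.assoc)
    also have "\<dots> = b \<otimes> (b [^] (M * (l * k)) \<otimes> c [^] k)"
      by (simp add: m_assoc b_pow_M_commute)
    finally have "x \<otimes> b = a [^] i \<otimes> b [^] (j + 1 + M * (l * k)) \<otimes> c [^] k"
      by (simp add: x m_assoc int_pow_mult)
    then show ?case by blast
  qed
  then show thesis using that by blast
qed

end

section \<open>A permutation representation of \<open>K\<close>\<close>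

text \<open>An integer function as a function on the residues \<open>{0..<n}\<close>, undefined elsewhere so that
  it is an extensional permutation. Composition is composition of the integer functions
  provided that the outer one preserves congruence.\<close>

definition residue_map :: "int \<Rightarrow> (int \<Rightarrow> int) \<Rightarrow> int \<Rightarrow> int" where
  "residue_map n f = (\<lambda>x\<in>{0..<n}. f x mod n)"

definition respects_mod :: "int \<Rightarrow> (int \<Rightarrow> int) \<Rightarrow> bool" where
  "respects_mod n f \<longleftrightarrow> (\<forall>x y. n dvd x - y \<longrightarrow> n dvd f x - f y)"

lemma respects_modD: "respects_mod n f \<Longrightarrow> n dvd x - y \<Longrightarrow> n dvd f x - f y"
  by (simp add: respects_mod_def)

lemma residue_map_cong: "(\<And>x. n dvd f x - g x) \<Longrightarrow> residue_map n f = residue_map n g"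
  unfolding residue_map_def by (intro restrict_ext) (simp add: mod_eq_dvd_iff)

lemma residue_map_eqD:
  "residue_map n f = residue_map n g \<Longrightarrow> 0 \<le> x \<Longrightarrow> x < n \<Longrightarrow> n dvd f x - g x"
  unfolding residue_map_def by (drule fun_cong[of _ _ x]) (simp add: mod_eq_dvd_iff)

lemma compose_residue_map:
  assumes "n > 0" "respects_mod n f"
  shows "compose {0..<n} (residue_map n f) (residue_map n g) = residue_map n (\<lambda>x. f (g x))"
proof
  fix x
  have "n dvd g x mod n - g x" by (simp add: mod_eq_dvd_iff[symmetric])
  then have "n dvd f (g x mod n) - f (g x)" by (rule respects_modD[OF assms(2)])
  then show "compose {0..<n} (residue_map n f) (residue_map n g) x = residue_map n (\<lambda>x. f (g x)) x"
    using assms(1) by (simp add: compose_def residue_map_def mod_eq_dvd_iff)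
qed

lemma residue_map_mult:
  assumes "n > 0" "respects_mod n f" "residue_map n f \<in> Bij {0..<n}" "residue_map n g \<in> Bij {0..<n}"
  shows "residue_map n f \<otimes>\<^bsub>BijGroup {0..<n}\<^esub> residue_map n g = residue_map n (\<lambda>x. f (g x))"
  using assms by (simp add: BijGroup_def compose_residue_map)

lemma residue_map_comp_Bij:
  assumes "n > 0" "respects_mod n f" "residue_map n f \<in> Bij {0..<n}" "residue_map n g \<in> Bij {0..<n}"
  shows "residue_map n (\<lambda>x. f (g x)) \<in> Bij {0..<n}"
  using compose_Bij[OF assms(3,4)] assms(1,2) by (simp add: compose_residue_map)

text \<open>A family of integer functions that is additive in its parameter modulo \<open>n\<close> is a one-parameter
  group of permutations, so that integer powers of its member at \<open>1\<close> are known explicitly.\<close>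

lemma residue_map_flow:
  fixes F :: "int \<Rightarrow> int \<Rightarrow> int"
  assumes n: "n > 0" and resp: "\<And>i. respects_mod n (F i)"
    and id: "\<And>x. F 0 x = x" and add: "\<And>i j x. n dvd F i (F j x) - F (i + j) x"
  shows "residue_map n (F i) \<in> Bij {0..<n}"
    and "residue_map n (F i) = residue_map n (F 1) [^]\<^bsub>BijGroup {0..<n}\<^esub> i"
proof -
  have comp: "compose {0..<n} (residue_map n (F i)) (residue_map n (F j)) = residue_map n (F (i + j))" for i j
    unfolding compose_residue_map[OF n resp] by (rule residue_map_cong) (rule add)
  have one: "residue_map n (F 0) = (\<lambda>x\<in>{0..<n}. x)"
    unfolding residue_map_def by (intro restrict_ext) (simp add: id)
  have fs: "residue_map n (F i) \<in> {0..<n} \<rightarrow> {0..<n}" for i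
    using n by (auto simp: residue_map_def)
  have inv: "residue_map n (F i) (residue_map n (F (- i)) x) = x" if "x \<in> {0..<n}" for i x
    using fun_cong[OF comp[of i "- i"], of x] that one by (simp add: compose_def)
  have bij: "residue_map n (F i) \<in> Bij {0..<n}" for i
    unfolding Bij_def
  proof (intro IntI CollectI)
    show "residue_map n (F i) \<in> extensional {0..<n}" by (simp add: residue_map_def)
    show "bij_betw (residue_map n (F i)) {0..<n} {0..<n}"
      by (rule bij_betwI[OF fs[of i] fs[of "- i"]]) (use inv[where i = i] inv[where i = "- i"] in simp_all)
  qed
  then show "residue_map n (F i) \<in> Bij {0..<n}" .
  show "residue_map n (F i) = residue_map n (F 1) [^]\<^bsub>BijGroup {0..<n}\<^esub> i"
  proof (rule group.eq_int_powI[OF group_BijGroup])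
    show "residue_map n (F (i + 1)) = residue_map n (F i) \<otimes>\<^bsub>BijGroup {0..<n}\<^esub> residue_map n (F 1)" for i
      using bij comp by (simp add: BijGroup_def)
  qed (use bij one in \<open>simp_all add: BijGroup_def restrict_def\<close>)
qed

lemma triangular_cong:
  assumes "2 * s dvd x - y"
  shows "s dvd triangular x - triangular y"
proof -
  obtain t where t: "x - y = 2 * s * t" using assms by (auto elim: dvdE)
  have "2 * (triangular x - triangular y) = (x - y) * (x + y - 1)"
    unfolding right_diff_distrib two_triangular by (simp add: algebra_simps)
  then have "triangular x - triangular y = s * (t * (x + y - 1))" by (simp add: t)
  then show ?thesis by simp
qed

context macdonald_quotient
begin

text \<open>\<open>K\<close> acts from the left on the cosets of the subgroup generated by \<open>a\<close> and \<open>c\<close>. Write the residue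
  \<open>x\<close> for the coset of \<open>b [^] x\<close>. Then \<open>b\<close> is the translation by one, and \<open>c\<close> multiplies by \<open>1 + M * l\<close>
  because it conjugates \<open>b\<close> to that power. Conjugation by the inverse of \<open>a\<close> takes \<open>b\<close> to
  \<open>b \<otimes> c\<close>, up to a central power of \<open>a\<close>, which fixes every coset; the \<open>x\<close>-th power of this
  product lies in the coset of \<open>x + M * l * triangular x\<close>, modulo \<open>N\<close>. The functions below are the \<open>i\<close>-th powers of these three permutations.\<close>

definition perm_a where "perm_a i = (\<lambda>x. x + M * l * i * triangular x)"
definition perm_b where "perm_b j = (\<lambda>x :: int. x + j)"
definition perm_c where "perm_c k = (\<lambda>x. x + M * l * k * x)"

abbreviation "perms \<equiv> BijGroup {0..<N}"

lemma N_pos: "N > 0" and N_gt_2: "N > 2"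
proof -
  have "S > 0" by (simp add: S_def)
  with even_S have "S \<ge> 2" by (auto elim!: dvdE)
  then show "N > 2" using mult_mono[of 2 S 2 S] by (simp add: N_eq M_eq)
  then show "N > 0" by simp
qed

lemma N_dvd_M_S: "S dvd x \<Longrightarrow> N dvd M * y * x"
  by (auto simp: N_eq elim!: dvdE)

lemma N_dvd_M_M: "N dvd M * x * (M * y)"
  by (simp add: N_eq M_eq)

lemma M_dvd_N: "M dvd N"
  by (simp add: N_eq)

lemma N_dvd_triangular_diff: "M dvd x - y \<Longrightarrow> N dvd M * z * (triangular x - triangular y)"
  by (rule N_dvd_M_S, rule triangular_cong) (simp add: M_eq)

lemma respects_perm: "respects_mod N (perm_a i)" "respects_mod N (perm_b i)" "respects_mod N (perm_c i)"
proof -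
  show "respects_mod N (perm_a i)"
    unfolding respects_mod_def
  proof (intro allI impI)
    fix x y assume *: "N dvd x - y"
    have "N dvd (x - y) + M * (l * i) * (triangular x - triangular y)"
      by (intro dvd_add * N_dvd_triangular_diff dvd_trans[OF M_dvd_N * ])
    then show "N dvd perm_a i x - perm_a i y" by (simp add: perm_a_def algebra_simps)
  qed
  show "respects_mod N (perm_c i)"
    unfolding respects_mod_def
  proof (intro allI impI)
    fix x y assume *: "N dvd x - y"
    then have "N dvd (x - y) * (1 + M * l * i)" by simp
    then show "N dvd perm_c i x - perm_c i y" by (simp add: perm_c_def algebra_simps)
  qed
qed (simp add: respects_mod_def perm_b_def)

lemma perm_a_flow: "residue_map N (perm_a i) \<in> Bij {0..<N}"
  "residue_map N (perm_a i) = residue_map N (perm_a 1) [^]\<^bsub>perms\<^esub> i"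
proof -
  have *: "N dvd perm_a i (perm_a j x) - perm_a (i + j) x" for i j x
  proof -
    have "N dvd M * (l * i) * (triangular (perm_a j x) - triangular x)"
      by (rule N_dvd_triangular_diff) (simp add: perm_a_def)
    also have "\<dots> = perm_a i (perm_a j x) - perm_a (i + j) x"
      by (simp add: perm_a_def algebra_simps)
    finally show ?thesis .
  qed
  show "residue_map N (perm_a i) \<in> Bij {0..<N}"
    by (rule residue_map_flow(1)[where F = perm_a, OF N_pos respects_perm(1) _ * ]) (simp add: perm_a_def)
  show "residue_map N (perm_a i) = residue_map N (perm_a 1) [^]\<^bsub>perms\<^esub> i"
    by (rule residue_map_flow(2)[where F = perm_a, OF N_pos respects_perm(1) _ * ]) (simp add: perm_a_def)
qed

lemma perm_b_flow: "residue_map N (perm_b i) \<in> Bij {0..<N}"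
  "residue_map N (perm_b i) = residue_map N (perm_b 1) [^]\<^bsub>perms\<^esub> i"
  by (rule residue_map_flow[where F = perm_b, OF N_pos respects_perm(2)]; simp add: perm_b_def)+

lemma perm_c_flow: "residue_map N (perm_c i) \<in> Bij {0..<N}"
  "residue_map N (perm_c i) = residue_map N (perm_c 1) [^]\<^bsub>perms\<^esub> i"
proof -
  have *: "N dvd perm_c i (perm_c j x) - perm_c (i + j) x" for i j x
  proof -
    have "N dvd M * (l * i) * (M * (l * j * x))" by (rule N_dvd_M_M)
    also have "\<dots> = perm_c i (perm_c j x) - perm_c (i + j) x"
      by (simp add: perm_c_def algebra_simps)
    finally show ?thesis .
  qed
  show "residue_map N (perm_c i) \<in> Bij {0..<N}"
    by (rule residue_map_flow(1)[where F = perm_c, OF N_pos respects_perm(3) _ * ]) (simp add: perm_c_def)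
  show "residue_map N (perm_c i) = residue_map N (perm_c 1) [^]\<^bsub>perms\<^esub> i"
    by (rule residue_map_flow(2)[where F = perm_c, OF N_pos respects_perm(3) _ * ]) (simp add: perm_c_def)
qed

lemmas perm_mult = residue_map_mult[OF N_pos] residue_map_comp_Bij[OF N_pos]
  respects_perm perm_a_flow(1) perm_b_flow(1) perm_c_flow(1)

text \<open>The relation \<open>a b = b a c\<close> holds because \<open>triangular (x + 1)\<close> exceeds \<open>triangular x\<close> by \<open>x\<close>,
  the term that \<open>c\<close> contributes.\<close>

lemma perm_commutator:
  "commutator perms (residue_map N (perm_a 1)) (residue_map N (perm_b 1)) = residue_map N (perm_c 1)"
proof -
  interpret P: group perms by (rule group_BijGroup)
  let ?a = "residue_map N (perm_a 1)" and ?b = "residue_map N (perm_b 1)" and ?c = "residue_map N (perm_c 1)"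
  have carr: "?a \<in> carrier perms" "?b \<in> carrier perms" "?c \<in> carrier perms"
    using perm_a_flow(1) perm_b_flow(1) perm_c_flow(1) by (simp_all add: BijGroup_def)
  have "N dvd perm_a 1 (perm_b 1 x) - perm_b 1 (perm_a 1 (perm_c 1 x))" for x
  proof -
    have "N dvd M * (- l) * (triangular (perm_c 1 x) - triangular x)"
      by (rule N_dvd_triangular_diff) (simp add: perm_c_def)
    also have "\<dots> = perm_a 1 (perm_b 1 x) - perm_b 1 (perm_a 1 (perm_c 1 x))"
      by (simp add: perm_a_def perm_b_def triangular_step) (simp add: perm_c_def algebra_simps)
    finally show ?thesis .
  qed
  then have "residue_map N (\<lambda>x. perm_a 1 (perm_b 1 x)) = residue_map N (\<lambda>x. perm_b 1 (perm_a 1 (perm_c 1 x)))"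
    by (rule residue_map_cong)
  then have "?a \<otimes>\<^bsub>perms\<^esub> ?b = ?b \<otimes>\<^bsub>perms\<^esub> (?a \<otimes>\<^bsub>perms\<^esub> ?c)"
    by (simp add: perm_mult)
  then show ?thesis using carr by (simp add: commutator_def P.m_assoc)
qed

lemma perm_relations: "macdonald_relations perms m l (residue_map N (perm_a 1)) (residue_map N (perm_b 1))"
proof -
  interpret P: group perms by (rule group_BijGroup)
  let ?a = "residue_map N (perm_a 1)" and ?b = "residue_map N (perm_b 1)" and ?c = "residue_map N (perm_c 1)"
  have carr: "?a \<in> carrier perms" "?b \<in> carrier perms" "?c \<in> carrier perms"
    using perm_a_flow(1) perm_b_flow(1) perm_c_flow(1) by (simp_all add: BijGroup_def)
  have id: "residue_map N (\<lambda>x. x) = \<one>\<^bsub>perms\<^esub>"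
    unfolding BijGroup_def residue_map_def by (auto intro!: restrict_ext)
  have a': "?a [^]\<^bsub>perms\<^esub> (1 + M * l) = ?a"
    unfolding perm_a_flow(2)[symmetric]
  proof (rule residue_map_cong)
    fix x
    have "N dvd M * l * (M * (l * triangular x))" by (rule N_dvd_M_M)
    then show "N dvd perm_a (1 + M * l) x - perm_a 1 x" by (simp add: perm_a_def algebra_simps)
  qed
  have "N dvd perm_a 1 (perm_c 1 x) - perm_c 1 (perm_a 1 x)" for x
  proof -
    have "N dvd M * l * (triangular (perm_c 1 x) - triangular x) + M * l * (M * (- l * triangular x))"
      by (intro dvd_add N_dvd_M_M N_dvd_triangular_diff) (simp add: perm_c_def)
    also have "\<dots> = perm_a 1 (perm_c 1 x) - perm_c 1 (perm_a 1 x)"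
      unfolding perm_a_def by (simp add: algebra_simps) (simp add: perm_c_def algebra_simps)
    finally show ?thesis .
  qed
  then have ac: "?a \<otimes>\<^bsub>perms\<^esub> ?c = ?c \<otimes>\<^bsub>perms\<^esub> ?a"
    by (simp add: perm_mult residue_map_cong)
  have cb: "?c \<otimes>\<^bsub>perms\<^esub> ?b = ?b [^]\<^bsub>perms\<^esub> (1 + M * l) \<otimes>\<^bsub>perms\<^esub> ?c"
    unfolding perm_b_flow(2)[symmetric]
    by (simp add: perm_mult)
       (simp add: perm_b_def perm_c_def algebra_simps)
  have order: "?a [^]\<^bsub>perms\<^esub> N = \<one>\<^bsub>perms\<^esub>" "?b [^]\<^bsub>perms\<^esub> N = \<one>\<^bsub>perms\<^esub>" "?c [^]\<^bsub>perms\<^esub> S = \<one>\<^bsub>perms\<^esub>"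
    unfolding perm_a_flow(2)[symmetric] perm_b_flow(2)[symmetric] perm_c_flow(2)[symmetric] id[symmetric]
    by (rule residue_map_cong; simp add: perm_a_def perm_b_def perm_c_def N_eq)+
  have "inv\<^bsub>perms\<^esub> ?c \<otimes>\<^bsub>perms\<^esub> ?a \<otimes>\<^bsub>perms\<^esub> ?c = ?a [^]\<^bsub>perms\<^esub> (1 + M * l)"
    using carr by (simp add: a' P.conj_eq_iff ac)
  moreover have "?c \<otimes>\<^bsub>perms\<^esub> ?b \<otimes>\<^bsub>perms\<^esub> inv\<^bsub>perms\<^esub> ?c = ?b [^]\<^bsub>perms\<^esub> (1 + M * l)"
    using carr by (simp add: cb P.m_assoc)
  ultimately show ?thesis
    unfolding P.macdonald_relations_iff[OF carr(1,2)] perm_commutator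
    using order by (simp only: M_def N_def S_def simp_thms)
qed

text \<open>The representation detects \<open>b\<close> and \<open>c\<close> faithfully, but not \<open>a\<close>; with its mirror image it
  separates all that is needed below.\<close>

lemma perm_representation:
  obtains \<rho> where "\<rho> \<in> hom K perms"
    "\<And>i j k. \<rho> (a [^] i \<otimes> b [^] j \<otimes> c [^] k) = residue_map N (\<lambda>x. perm_a i (perm_b j (perm_c k x)))"
proof -
  have "residue_map N (perm_a 1) \<in> carrier perms" "residue_map N (perm_b 1) \<in> carrier perms"
    using perm_a_flow(1) perm_b_flow(1) by (simp_all add: BijGroup_def)
  then obtain \<rho> where \<rho>: "\<rho> \<in> hom K perms" "\<rho> a = residue_map N (perm_a 1)" "\<rho> b = residue_map N (perm_b 1)"
    using representation[OF group_BijGroup _ _ perm_relations] by blast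
  interpret \<rho>: group_hom K perms \<rho>
    by (intro group_hom.intro group_hom_axioms.intro group_axioms group_BijGroup \<rho>(1))
  have c: "\<rho> c = residue_map N (perm_c 1)"
    by (simp add: \<rho>.hom_commutator \<rho>(2,3) perm_commutator)
  have "\<rho> (a [^] i \<otimes> b [^] j \<otimes> c [^] k) = residue_map N (\<lambda>x. perm_a i (perm_b j (perm_c k x)))" for i j k
  proof -
    have "\<rho> (a [^] i \<otimes> b [^] j \<otimes> c [^] k)
      = residue_map N (perm_a i) \<otimes>\<^bsub>perms\<^esub> (residue_map N (perm_b j) \<otimes>\<^bsub>perms\<^esub> residue_map N (perm_c k))"
      by (simp add: \<rho>.hom_int_pow c \<rho>(2,3) \<rho>.H.m_assoc \<rho>.hom_closed[of a, unfolded \<rho>(2)]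
          \<rho>.hom_closed[of b, unfolded \<rho>(3)] \<rho>.hom_closed[of c, unfolded c]
          perm_a_flow(2)[of i] perm_b_flow(2)[of j] perm_c_flow(2)[of k])
    then show ?thesis by (simp add: perm_mult)
  qed
  then show thesis using \<rho>(1) that by blast
qed

text \<open>In the representation \<open>b [^] j\<close> is the translation by \<open>j\<close>.\<close>

lemma b_pow_eq_one_iff: "b [^] (j :: int) = \<one> \<longleftrightarrow> N dvd j"
proof
  obtain \<rho> where \<rho>: "\<rho> \<in> hom K perms"
    "\<And>i j k. \<rho> (a [^] i \<otimes> b [^] j \<otimes> c [^] k) = residue_map N (\<lambda>x. perm_a i (perm_b j (perm_c k x)))"
    using perm_representation by metis
  assume "b [^] j = \<one>"
  then have "residue_map N (\<lambda>x. perm_a 0 (perm_b j (perm_c 0 x))) = residue_map N (\<lambda>x. perm_a 0 (perm_b 0 (perm_c 0 x)))"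
    using \<rho>(2)[of 0 j 0] \<rho>(2)[of 0 0 0] by simp
  from residue_map_eqD[OF this, of 0] show "N dvd j"
    using N_pos by (simp add: perm_a_def perm_b_def perm_c_def)
qed (rule b_pow_dvd)

lemma coprime_S_l: "S dvd l * x \<Longrightarrow> S dvd x"
  using l by (simp add: S_def coprime_dvd_mult_right_iff)

text \<open>This bounds the upper central series from above: if \<open>g\<close> commutes with \<open>b\<close> up to a central
  element of the known shape, its exponents are restricted. In the representation \<open>g\<close> becomes a
  quadratic function \<open>G\<close> modulo \<open>N\<close> and the central element a translation by \<open>M * q\<close>, so that \<open>G\<close>
  satisfies \<open>G (x + 1) = G x + 1 + M * q\<close>. Comparing \<open>x = 0\<close> and \<open>x = 1\<close> kills the second difference
  \<open>M * l * i\<close> of \<open>G\<close>.\<close>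

lemma commutator_with_b:
  fixes i j k p q :: int
  assumes g: "g = a [^] i \<otimes> b [^] j \<otimes> c [^] k"
    and comm: "g \<otimes> b = a [^] (M * p) \<otimes> b [^] (M * q) \<otimes> (b \<otimes> g)"
  shows "S dvd i" "q = 0 \<Longrightarrow> S dvd k"
proof -
  obtain \<rho> where \<rho>: "\<rho> \<in> hom K perms"
    "\<And>i j k. \<rho> (a [^] i \<otimes> b [^] j \<otimes> c [^] k) = residue_map N (\<lambda>x. perm_a i (perm_b j (perm_c k x)))"
    using perm_representation by metis
  interpret \<rho>: group_hom K perms \<rho>
    by (intro group_hom.intro group_hom_axioms.intro group_axioms group_BijGroup \<rho>(1))
  define G where "G = (\<lambda>x. perm_a i (perm_b j (perm_c k x)))"
  have g_carr: "g \<in> carrier K" by (simp add: g)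
  have bij: "\<rho> x \<in> Bij {0..<N}" if "x \<in> carrier K" for x
    using \<rho>.hom_closed[OF that] by (simp add: BijGroup_def)
  have rg: "\<rho> g = residue_map N G" by (simp add: g \<rho>(2) G_def)
  have rb: "\<rho> b = residue_map N (perm_b 1)"
    using \<rho>(2)[of 0 1 0] by (simp add: perm_a_def perm_b_def perm_c_def)
  have rz: "\<rho> (a [^] (M * p) \<otimes> b [^] (M * q)) = residue_map N (perm_b (M * q))"
  proof -
    have "N dvd perm_a (M * p) y - y" for y
    proof -
      have "N dvd M * l * (M * (p * triangular y))" by (rule N_dvd_M_M)
      then show ?thesis by (simp add: perm_a_def mult.assoc)
    qed
    then have "residue_map N (\<lambda>x. perm_a (M * p) (perm_b (M * q) x)) = residue_map N (perm_b (M * q))"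
      by (rule residue_map_cong)
    then show ?thesis using \<rho>(2)[of "M * p" "M * q" 0] by (simp add: perm_c_def)
  qed
  have "respects_mod N G" using respects_perm unfolding G_def respects_mod_def by simp
  then have 1: "\<rho> (g \<otimes> b) = residue_map N (\<lambda>x. G (x + 1))"
    using bij[of g] bij[of b] g_carr by (simp add: rg rb perm_mult) (simp add: perm_b_def)
  have bg: "\<rho> (b \<otimes> g) = residue_map N (\<lambda>x. G x + 1)"
    using bij[of g] bij[of b] g_carr by (simp add: rg rb perm_mult) (simp add: perm_b_def)
  have "\<rho> (a [^] (M * p) \<otimes> b [^] (M * q) \<otimes> (b \<otimes> g))
    = \<rho> (a [^] (M * p) \<otimes> b [^] (M * q)) \<otimes>\<^bsub>perms\<^esub> \<rho> (b \<otimes> g)"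
    using g_carr by (intro \<rho>.hom_mult) auto
  also have "\<dots> = residue_map N (\<lambda>x. perm_b (M * q) (G x + 1))"
    using bij[of "b \<otimes> g"] g_carr unfolding rz bg
    by (intro residue_map_mult[OF N_pos respects_perm(2) perm_b_flow(1)]) auto
  finally have "\<rho> (a [^] (M * p) \<otimes> b [^] (M * q) \<otimes> (b \<otimes> g)) = residue_map N (\<lambda>x. G x + 1 + M * q)"
    by (simp add: perm_b_def)
  then have eq: "residue_map N (\<lambda>x. G (x + 1)) = residue_map N (\<lambda>x. G x + 1 + M * q)"
    using 1 comm by simp
  have G: "N dvd G x - (x + M * l * k * x + j + M * l * i * triangular (x + j))" for x
  proof -
    have "N dvd M * (l * i) * (triangular (perm_b j (perm_c k x)) - triangular (x + j))"
      by (rule N_dvd_triangular_diff) (simp add: perm_b_def perm_c_def mult.assoc)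
    also have "\<dots> = G x - (x + M * l * k * x + j + M * l * i * triangular (x + j))"
      unfolding G_def perm_a_def by (simp add: algebra_simps) (simp add: perm_b_def perm_c_def algebra_simps)
    finally show ?thesis .
  qed
  \<comment> \<open>The difference equation at \<open>x\<close>, divided by \<open>M\<close>.\<close>
  have step: "S dvd l * (k + i * (x + j)) - q" if "x \<in> {0, 1}" for x
  proof -
    have "N dvd G (x + 1) - (G x + 1 + M * q)"
      using residue_map_eqD[OF eq, of x] that N_gt_2 by auto
    then have "N dvd G (x + 1) - (G x + 1 + M * q)
       - (G (x + 1) - (x + 1 + M * l * k * (x + 1) + j + M * l * i * triangular (x + 1 + j)))
       + (G x - (x + M * l * k * x + j + M * l * i * triangular (x + j)))"
      by (rule dvd_add[OF dvd_diff[OF _ G] G])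
    also have "\<dots> = M * (l * (k + i * (x + j)) - q)"
      using triangular_step[of "x + j"] by (simp add: algebra_simps)
    finally show ?thesis by (simp add: N_eq M_def)
  qed
  have "S dvd (l * (k + i * (1 + j)) - q) - (l * (k + i * (0 + j)) - q)"
    by (rule dvd_diff[OF step step]) auto
  then have "S dvd l * i" by (simp add: algebra_simps)
  then show "S dvd i" by (rule coprime_S_l)
  assume "q = 0"
  then have "S dvd l * (k + i * j)" using step[of 0] by simp
  then have "S dvd k + i * j" by (rule coprime_S_l)
  then show "S dvd k" using \<open>S dvd i\<close> dvd_add_left_iff[of S "i * j" k] by simp
qed

end

section \<open>The upper central series of \<open>K\<close>\<close>

declare upper_central.simps(2) [simp del]

text \<open>In an abelian group commutators vanish, and the conjugation relations reduce to
  \<open>x [^] (2 ^ m * l) = \<one>\<close>.\<close>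

lemma (in comm_group) macdonald_relations_abelian:
  assumes "x \<in> carrier G" "y \<in> carrier G"
    and "x [^] (2 ^ m :: int) = \<one>" "y [^] (2 ^ m :: int) = \<one>" "m > 1"
  shows "macdonald_relations G m l x y"
proof -
  have comm: "commutator G x y = \<one>"
    using assms(1,2) by (simp add: commutator_def m_comm[of "inv x" "inv y"] m_assoc)
  have "x [^] (2 ^ m * k :: int) = \<one>" "y [^] (2 ^ m * k :: int) = \<one>" for k
    using assms by (simp_all flip: int_pow_pow)
  moreover have "(2 :: int) ^ (2 * m - 1) = 2 ^ m * 2 ^ (m - 1)"
    using assms(5) by (simp add: mult_2 flip: power_add)
  ultimately show ?thesis
    using assms(1,2) by (simp add: macdonald_relations_iff comm int_pow_mult)
qed

lemma (in normal) r_coset_eq_iff: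
  assumes "u \<in> carrier G" "v \<in> carrier G"
  shows "H #> u = H #> v \<longleftrightarrow> (\<exists>z\<in>H. u = z \<otimes> v)"
proof
  assume "H #> u = H #> v"
  then have "u \<in> H #> v" using rcos_self[OF assms(1) subgroup_axioms] by simp
  then show "\<exists>z\<in>H. u = z \<otimes> v" by (auto simp: r_coset_def)
next
  assume "\<exists>z\<in>H. u = z \<otimes> v"
  then have "u \<in> H #> v" by (auto simp: r_coset_def)
  then show "H #> u = H #> v" using repr_independence[OF _ assms(2) subgroup_axioms] by simp
qed

lemma (in normal) coset_central_iff:
  assumes "x \<in> carrier G"
  shows "H #> x \<in> group_center (G Mod H) \<longleftrightarrow> (\<forall>y\<in>carrier G. \<exists>z\<in>H. x \<otimes> y = z \<otimes> (y \<otimes> x))"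
proof -
  have "H #> x \<in> group_center (G Mod H) \<longleftrightarrow> (\<forall>y\<in>carrier G. (H #> x) <#> (H #> y) = (H #> y) <#> (H #> x))"
    using assms by (auto simp: group_center_def FactGroup_def RCOSETS_def)
  also have "\<dots> \<longleftrightarrow> (\<forall>y\<in>carrier G. H #> (x \<otimes> y) = H #> (y \<otimes> x))"
    using assms by (simp add: rcos_sum)
  finally show ?thesis using assms by (simp add: r_coset_eq_iff)
qed

lemma (in group) upper_central_1: "upper_central G (Suc 0) = group_center G"
proof -
  interpret one: normal "{\<one>}" G by (rule one_is_normal)
  have "upper_central G (Suc 0) = {x \<in> carrier G. \<forall>y\<in>carrier G. x \<otimes> y = y \<otimes> x}"
    using one.coset_central_iff by (simp add: upper_central.simps(2) cong: conj_cong)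
  then show ?thesis by (simp add: group_center_def)
qed

lemma (in group) normal_group_center: "group_center G \<lhd> G"
  unfolding normal_inv_iff
proof (intro conjI subgroup_group_center ballI)
  fix x h assume "x \<in> carrier G" and h: "h \<in> group_center G"
  then have "x \<otimes> h \<otimes> inv x = h"
    using group_centerD(1)[OF h] by (simp add: group_centerD(2)[OF h, symmetric] m_assoc)
  then show "x \<otimes> h \<otimes> inv x \<in> group_center G" using h by simp
qed

lemma (in group) upper_central_2_iff:
  "g \<in> upper_central G 2 \<longleftrightarrow>
     g \<in> carrier G \<and> (\<forall>x\<in>carrier G. \<exists>z\<in>group_center G. g \<otimes> x = z \<otimes> (x \<otimes> g))"
  using normal.coset_central_iff[OF normal_group_center, of g]
  by (simp only: numeral_2_eq_2 upper_central.simps(2)[of G "Suc 0"] upper_central_1) auto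

lemma (in group) upper_central_2_mult:
  assumes "g \<in> upper_central G 2" "h \<in> upper_central G 2"
  shows "g \<otimes> h \<in> upper_central G 2"
  unfolding upper_central_2_iff
proof (intro conjI ballI)
  have carr: "g \<in> carrier G" "h \<in> carrier G" using assms by (simp_all add: upper_central_2_iff)
  then show "g \<otimes> h \<in> carrier G" by simp
  fix x assume x: "x \<in> carrier G"
  obtain z where z: "z \<in> group_center G" "g \<otimes> x = z \<otimes> (x \<otimes> g)"
    using assms(1) x unfolding upper_central_2_iff by blast
  obtain w where w: "w \<in> group_center G" "h \<otimes> x = w \<otimes> (x \<otimes> h)"
    using assms(2) x unfolding upper_central_2_iff by blast
  note zw = group_centerD(1)[OF z(1)] group_centerD(1)[OF w(1)]
  have "g \<otimes> h \<otimes> x = g \<otimes> w \<otimes> (x \<otimes> h)" using carr x zw by (simp add: m_assoc w(2))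
  also have "g \<otimes> w = w \<otimes> g" using group_centerD(2)[OF w(1) carr(1)] by simp
  also have "w \<otimes> g \<otimes> (x \<otimes> h) = w \<otimes> (g \<otimes> x) \<otimes> h" using carr x zw by (simp add: m_assoc)
  also have "\<dots> = (w \<otimes> z) \<otimes> (x \<otimes> (g \<otimes> h))" using carr x zw by (simp add: m_assoc z(2))
  finally show "\<exists>z\<in>group_center G. g \<otimes> h \<otimes> x = z \<otimes> (x \<otimes> (g \<otimes> h))"
    using subgroup.m_closed[OF subgroup_group_center w(1) z(1)] by blast
qed

context macdonald_quotient
begin

text \<open>The exponent sums of \<open>a\<close> and of \<open>b\<close> modulo \<open>2^m\<close>, that is, the two coordinates of the
  abelianization of \<open>K\<close>. They exist, and are determined, by the universal property.\<close>

definition "degree_a = (SOME f. f \<in> hom K (integer_mod_group (2 ^ m)) \<and> f a = 1 \<and> f b = 0)"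
definition "degree_b = (SOME f. f \<in> hom K (integer_mod_group (2 ^ m)) \<and> f a = 0 \<and> f b = 1)"

lemma degree_hom: "degree_a \<in> hom K (integer_mod_group (2 ^ m))" "degree_b \<in> hom K (integer_mod_group (2 ^ m))"
  and degree_generators: "degree_a a = 1" "degree_a b = 0" "degree_b a = 0" "degree_b b = 1"
proof -
  interpret Z: comm_group "integer_mod_group (2 ^ m)" by (rule abelian_integer_mod_group)
  have "macdonald_relations (integer_mod_group (2 ^ m)) m l x y"
    if "x \<in> {0, 1}" "y \<in> {0, 1}" for x y
    using that m
    by (intro Z.macdonald_relations_abelian)
       (auto simp: int_pow_integer_mod_group carrier_integer_mod_group)
  then have *: "\<exists>f. f \<in> hom K (integer_mod_group (2 ^ m)) \<and> f a = x \<and> f b = y"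
    if "x \<in> {0, 1}" "y \<in> {0, 1}" for x y
    using character[OF Z.group_axioms, of x y] that m
    by (auto simp: carrier_integer_mod_group)
  show "degree_a \<in> hom K (integer_mod_group (2 ^ m))" "degree_a a = 1" "degree_a b = 0"
    using someI_ex[OF *[of 1 0]] unfolding degree_a_def by simp_all
  show "degree_b \<in> hom K (integer_mod_group (2 ^ m))" "degree_b a = 0" "degree_b b = 1"
    using someI_ex[OF *[of 0 1]] unfolding degree_b_def by simp_all
qed

lemma degree_mult:
  assumes "x \<in> carrier K" "y \<in> carrier K"
  shows "degree_a (x \<otimes> y) = (degree_a x + degree_a y) mod M"
    "degree_b (x \<otimes> y) = (degree_b x + degree_b y) mod M"
  using assms hom_mult[OF degree_hom(1)] hom_mult[OF degree_hom(2)] by (simp_all add: M_def)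

lemma degree_range:
  assumes "x \<in> carrier K"
  shows "degree_a x \<in> {0..<M}" "degree_b x \<in> {0..<M}"
  using assms hom_in_carrier[OF degree_hom(1), of x] hom_in_carrier[OF degree_hom(2), of x]
  by (simp_all add: M_def carrier_integer_mod_group)

lemma degree_pow:
  assumes "x \<in> carrier K"
  shows "degree_a (x [^] (i :: int)) = (i * degree_a x) mod M"
    "degree_b (x [^] (i :: int)) = (i * degree_b x) mod M"
  using hom_int_pow[OF degree_hom(1) assms group_axioms] hom_int_pow[OF degree_hom(2) assms group_axioms]
  by (simp_all add: int_pow_integer_mod_group M_def)

lemma degree_commutator:
  assumes "x \<in> carrier K" "y \<in> carrier K"
  shows "degree_a (commutator K x y) = 0" "degree_b (commutator K x y) = 0"
proof -
  have inv: "u [^] (- 1 :: int) = inv u" if "u \<in> carrier K" for u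
    using that by (simp add: int_pow_neg)
  show "degree_a (commutator K x y) = 0" "degree_b (commutator K x y) = 0"
    using assms degree_pow[of x "- 1"] degree_pow[of y "- 1"]
    by (simp_all add: commutator_def degree_mult inv mod_simps)
qed

lemma degree_normal_form:
  "degree_a (a [^] (i :: int) \<otimes> b [^] (j :: int) \<otimes> c [^] (k :: int)) = i mod M"
  "degree_b (a [^] (i :: int) \<otimes> b [^] (j :: int) \<otimes> c [^] (k :: int)) = j mod M"
  by (simp_all add: degree_mult degree_pow degree_generators degree_commutator mod_simps)

lemma S_dvd_mod_M [simp]: "S dvd i mod M \<longleftrightarrow> S dvd i"
  by (rule dvd_mod_iff) (simp add: M_eq)

lemmas a_pow_eq_one_iff = macdonald_quotient.b_pow_eq_one_iff[OF mirror]

text \<open>Commuting with \<open>b\<close> forces \<open>a [^] (M * l * triangular i)\<close> to vanish, so \<open>S\<close> divides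
  \<open>triangular i\<close> and \<open>M = 2 * S\<close> divides \<open>i * (i - 1)\<close>; here \<open>i - 1\<close> is odd.\<close>

lemma a_pow_commute_b_imp:
  assumes "a [^] i \<otimes> b = b \<otimes> a [^] i" "S dvd i"
  shows "M dvd i"
proof -
  have "inv b \<otimes> a [^] i \<otimes> b = a [^] i" using assms(1) by (simp add: conj_eq_iff)
  then have "a [^] (- M * l * triangular i) = \<one>"
    using conj_b_a_pow[of i] c_pow_dvd[OF assms(2)] by simp
  then have "N dvd M * (l * triangular i)"
    by (simp add: a_pow_eq_one_iff mult.assoc)
  then have "S dvd l * triangular i" by (simp add: N_eq M_def)
  then have "S dvd triangular i" by (rule coprime_S_l)
  then have "M dvd i * (i - 1)" unfolding two_triangular[symmetric] M_eq by simp
  moreover have "odd (i - 1)" using even_S assms(2) dvd_trans by auto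
  ultimately show "M dvd i" by (simp add: M_def coprime_dvd_mult_left_iff)
qed

lemma normal_form_b_first:
  assumes "g \<in> carrier K"
  obtains i j k :: int where "g = b [^] j \<otimes> a [^] i \<otimes> inv c [^] k" "degree_b g = j mod M"
proof -
  obtain j i k :: int where g: "g = b [^] j \<otimes> a [^] i \<otimes> inv c [^] k"
    using macdonald_quotient.normal_form[OF mirror assms] unfolding c_mirror by metis
  have "degree_b g = j mod M"
    by (simp add: g degree_mult degree_pow degree_generators degree_commutator int_pow_inv flip: int_pow_neg)
  with g show thesis by (rule that)
qed

text \<open>The mirror image of the lemma on commutators with \<open>b\<close> speaks about the normal form with \<open>b\<close> in
  front. Its exponents may differ from those of the other normal form, but the degrees agree.\<close>

lemma commutator_with_a:
  assumes "g \<in> carrier K" "g \<otimes> a = a [^] (M * p) \<otimes> b [^] (M * q) \<otimes> (a \<otimes> g)"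
  shows "S dvd degree_b g"
proof -
  obtain i j k :: int where g: "g = b [^] j \<otimes> a [^] i \<otimes> inv c [^] k" "degree_b g = j mod M"
    using normal_form_b_first[OF assms(1)] .
  have "g \<otimes> a = b [^] (M * q) \<otimes> a [^] (M * p) \<otimes> (a \<otimes> g)"
    using assms(2) by (simp add: b_pow_M_commute)
  then have "S dvd j"
    using macdonald_quotient.commutator_with_b(1)[OF mirror, of g j i k q p] g(1) unfolding c_mirror by simp
  then show ?thesis by (simp add: g(2))
qed

text \<open>A central element commutes with both generators. The two commutator lemmas make \<open>c [^] k\<close> trivial
  and \<open>i\<close>, \<open>j\<close> multiples of \<open>S\<close>; since then \<open>a [^] i\<close> commutes with \<open>b\<close> and \<open>b [^] j\<close> with \<open>a\<close>, the
  exponents are even multiples of \<open>S\<close>.\<close>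

lemma group_center_eq: "group_center K = {a [^] (M * i) \<otimes> b [^] (M * j) | i j. True}"
proof (intro equalityI subsetI)
  fix z assume z: "z \<in> group_center K"
  note zc = group_centerD(1)[OF z]
  obtain i j k :: int where nf: "z = a [^] i \<otimes> b [^] j \<otimes> c [^] k"
    using normal_form[OF zc] by metis
  have "z \<otimes> b = a [^] (M * 0) \<otimes> b [^] (M * 0) \<otimes> (b \<otimes> z)" "z \<otimes> a = a [^] (M * 0) \<otimes> b [^] (M * 0) \<otimes> (a \<otimes> z)"
    using zc group_centerD(2)[OF z] by simp_all
  then have Sik: "S dvd i" "S dvd k" and "S dvd degree_b z"
    using commutator_with_b[OF nf] commutator_with_a[OF zc] by blast+
  then have Sj: "S dvd j" by (simp add: nf degree_normal_form)
  have z_eq: "z = a [^] i \<otimes> b [^] j" using nf c_pow_dvd[OF Sik(2)] by simp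
  have "a [^] i \<otimes> b \<otimes> b [^] j = b \<otimes> a [^] i \<otimes> b [^] j"
    using group_centerD(2)[OF z, of b] int_pow_commute[of b b j] by (simp add: z_eq m_assoc)
  then have "M dvd i" using a_pow_commute_b_imp Sik(1) by simp
  have "a [^] i \<otimes> (b [^] j \<otimes> a) = a [^] i \<otimes> (a \<otimes> b [^] j)"
    using group_centerD(2)[OF z, of a] int_pow_commute[of a a i] by (simp add: z_eq flip: m_assoc)
  then have "M dvd j" using macdonald_quotient.a_pow_commute_b_imp[OF mirror _ Sj] by simp
  show "z \<in> {a [^] (M * i) \<otimes> b [^] (M * j) | i j. True}"
    using z_eq \<open>M dvd i\<close> \<open>M dvd j\<close> by (auto elim!: dvdE)
qed (auto intro: subgroup.m_closed[OF subgroup_group_center] a_pow_M_central b_pow_M_central)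

text \<open>Elements that commute with \<open>g\<close> modulo the centre form a subgroup, so the generators suffice.\<close>

lemma upper_central_2I:
  assumes g: "g \<in> carrier K"
    and za: "z \<in> group_center K" "g \<otimes> a = z \<otimes> (a \<otimes> g)"
    and zb: "w \<in> group_center K" "g \<otimes> b = w \<otimes> (b \<otimes> g)"
  shows "g \<in> upper_central K 2"
proof -
  have ext: "\<exists>z\<in>group_center K. g \<otimes> (x \<otimes> y) = z \<otimes> (x \<otimes> y \<otimes> g)"
    if x: "x \<in> carrier K" "y \<in> carrier K" and u: "u \<in> group_center K" "g \<otimes> x = u \<otimes> (x \<otimes> g)"
      and v: "v \<in> group_center K" "g \<otimes> y = v \<otimes> (y \<otimes> g)" for x y u v
  proof -
    note uv = group_centerD(1)[OF u(1)] group_centerD(1)[OF v(1)]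
    have "g \<otimes> (x \<otimes> y) = u \<otimes> (x \<otimes> g) \<otimes> y" using g x by (simp add: u(2)[symmetric] m_assoc)
    also have "\<dots> = u \<otimes> (x \<otimes> v) \<otimes> (y \<otimes> g)" using g x uv by (simp add: m_assoc v(2))
    also have "x \<otimes> v = v \<otimes> x" using group_centerD(2)[OF v(1) x(1)] by simp
    finally have "g \<otimes> (x \<otimes> y) = (u \<otimes> v) \<otimes> (x \<otimes> y \<otimes> g)" using g x uv by (simp add: m_assoc)
    then show ?thesis using subgroup.m_closed[OF subgroup_group_center u(1) v(1)] by blast
  qed
  have "\<exists>z\<in>group_center K. g \<otimes> x = z \<otimes> (x \<otimes> g)" if "x \<in> carrier K" for x
    using that
  proof (induction rule: generator_induct)
    case one
    then show ?case using g subgroup.one_closed[OF subgroup_group_center] by (intro bexI[of _ \<one>]) simp_all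
  next
    case (a x)
    then show ?case using ext[of x a] za by blast
  next
    case (b x)
    then show ?case using ext[of x b] zb by blast
  qed
  then show ?thesis using g by (simp add: upper_central_2_iff)
qed

lemma a_pow_in_upper_central_2:
  assumes "S dvd i"
  shows "a [^] i \<in> upper_central K 2"
proof (rule upper_central_2I)
  show "\<one> \<in> group_center K" by (rule subgroup.one_closed[OF subgroup_group_center])
  show "a [^] i \<otimes> a = \<one> \<otimes> (a \<otimes> a [^] i)" by (simp add: a_pow_commute_a)
  let ?z = "a [^] (M * (- l * triangular i))"
  show "?z \<in> group_center K" by (rule a_pow_M_central)
  have "inv b \<otimes> a [^] i \<otimes> b = a [^] i \<otimes> ?z"
    using conj_b_a_pow[of i] c_pow_dvd[OF assms] by (simp add: mult.assoc)
  then have "a [^] i \<otimes> b = b \<otimes> (a [^] i \<otimes> ?z)" by (subst (asm) conj_eq_iff) simp_all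
  also have "\<dots> = b \<otimes> a [^] i \<otimes> ?z" by (simp add: m_assoc)
  also have "\<dots> = ?z \<otimes> (b \<otimes> a [^] i)" by (rule a_pow_M_commute[symmetric]) simp
  finally show "a [^] i \<otimes> b = ?z \<otimes> (b \<otimes> a [^] i)" .
qed simp

lemma c_pow_in_upper_central_2: "c [^] (k :: int) \<in> upper_central K 2"
proof (rule upper_central_2I)
  let ?z = "a [^] (M * (- l * k))" and ?w = "b [^] (M * (l * k))"
  show "?z \<in> group_center K" "?w \<in> group_center K" by (rule a_pow_M_central b_pow_M_central)+
  have "c [^] k \<otimes> a = a \<otimes> c [^] k \<otimes> ?z" using c_pow_a_pow[of k 1] by (simp add: mult.assoc)
  also have "\<dots> = ?z \<otimes> (a \<otimes> c [^] k)" by (rule a_pow_M_commute[symmetric]) simp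
  finally show "c [^] k \<otimes> a = ?z \<otimes> (a \<otimes> c [^] k)" .
  have "c [^] k \<otimes> b = b \<otimes> c [^] k \<otimes> ?w" using c_pow_b_pow[of k 1] by (simp add: mult.assoc)
  also have "\<dots> = ?w \<otimes> (b \<otimes> c [^] k)" by (rule b_pow_M_commute[symmetric]) simp
  finally show "c [^] k \<otimes> b = ?w \<otimes> (b \<otimes> c [^] k)" .
qed simp

text \<open>The second centre is determined by the abelianization: it is the preimage of the multiples of
  \<open>2^(m-1)\<close> in both coordinates.\<close>

lemma upper_central_2_eq:
  "upper_central K 2 = {g \<in> carrier K. S dvd degree_a g \<and> S dvd degree_b g}"
proof (intro equalityI subsetI)
  fix g assume g: "g \<in> upper_central K 2"
  then have carr: "g \<in> carrier K"
    and central: "\<And>x. x \<in> carrier K \<Longrightarrow> \<exists>z\<in>group_center K. g \<otimes> x = z \<otimes> (x \<otimes> g)"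
    by (auto simp: upper_central_2_iff)
  obtain i j k :: int where nf: "g = a [^] i \<otimes> b [^] j \<otimes> c [^] k"
    using normal_form[OF carr] by metis
  obtain p q where "g \<otimes> b = a [^] (M * p) \<otimes> b [^] (M * q) \<otimes> (b \<otimes> g)"
    using central[of b] by (auto simp: group_center_eq)
  then have "S dvd degree_a g" using commutator_with_b(1)[OF nf] by (simp add: nf degree_normal_form)
  moreover obtain p q where "g \<otimes> a = a [^] (M * p) \<otimes> b [^] (M * q) \<otimes> (a \<otimes> g)"
    using central[of a] by (auto simp: group_center_eq)
  then have "S dvd degree_b g" using commutator_with_a[OF carr] by blast
  ultimately show "g \<in> {g \<in> carrier K. S dvd degree_a g \<and> S dvd degree_b g}" using carr by simp
next
  fix g assume "g \<in> {g \<in> carrier K. S dvd degree_a g \<and> S dvd degree_b g}"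
  then have carr: "g \<in> carrier K" and dvd: "S dvd degree_a g" "S dvd degree_b g" by auto
  obtain i j k :: int where nf: "g = a [^] i \<otimes> b [^] j \<otimes> c [^] k"
    using normal_form[OF carr] by metis
  then have "S dvd i" "S dvd j" using dvd by (simp_all add: degree_normal_form)
  then show "g \<in> upper_central K 2"
    unfolding nf
    by (intro upper_central_2_mult a_pow_in_upper_central_2 c_pow_in_upper_central_2
        macdonald_quotient.a_pow_in_upper_central_2[OF mirror])
qed

text \<open>The subgroup in the statement is the kernel of the abelianization, that is, the commutator
  subgroup of \<open>K\<close>.\<close>

lemma center_times_c_eq:
  "upper_central K 1 <#> generate K {c} = {g \<in> carrier K. degree_a g = 0 \<and> degree_b g = 0}"
proof -
  have "upper_central K 1 <#> generate K {c} = {a [^] (M * i) \<otimes> b [^] (M * j) \<otimes> c [^] (k :: int) | i j k. True}"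
    unfolding One_nat_def upper_central_1 group_center_eq set_mult_def
    by (auto simp: generate_pow)
  also have "\<dots> = {g \<in> carrier K. degree_a g = 0 \<and> degree_b g = 0}"
  proof (intro equalityI subsetI)
    fix g assume "g \<in> {g \<in> carrier K. degree_a g = 0 \<and> degree_b g = 0}"
    then have carr: "g \<in> carrier K" and deg: "degree_a g = 0" "degree_b g = 0" by auto
    obtain i j k :: int where nf: "g = a [^] i \<otimes> b [^] j \<otimes> c [^] k"
      using normal_form[OF carr] by metis
    then have "M dvd i" "M dvd j" using deg by (simp_all add: degree_normal_form mod_eq_0_iff_dvd)
    then show "g \<in> {a [^] (M * i) \<otimes> b [^] (M * j) \<otimes> c [^] (k :: int) | i j k. True}"
      using nf by (auto elim!: dvdE)
  qed (auto simp: degree_normal_form)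
  finally show ?thesis .
qed

end

section \<open>Automorphisms acting trivially on a central quotient\<close>

lemma carrier_AutoGroup [simp]: "carrier (AutoGroup G) = auto G"
  by (simp add: AutoGroup_def)

lemma one_AutoGroup: "\<one>\<^bsub>AutoGroup G\<^esub> = (\<lambda>x\<in>carrier G. x)"
  by (simp add: AutoGroup_def BijGroup_def)

lemma mult_AutoGroup:
  "f \<in> auto G \<Longrightarrow> g \<in> auto G \<Longrightarrow> f \<otimes>\<^bsub>AutoGroup G\<^esub> g = compose (carrier G) f g"
  by (simp add: AutoGroup_def BijGroup_def auto_def)

lemma autoD:
  assumes "f \<in> auto G"
  shows "f \<in> hom G G" "f \<in> extensional (carrier G)" "bij_betw f (carrier G) (carrier G)"
    "x \<in> carrier G \<Longrightarrow> f x \<in> carrier G"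
  using assms by (auto simp: auto_def Bij_def hom_def)

context group
begin

text \<open>An automorphism that maps every coset into itself maps it onto itself, because distinct cosets
  are disjoint and together they are hit completely.\<close>

lemma Aut_ker_iff:
  assumes "upper_central G i \<lhd> G"
  shows "f \<in> Aut_ker i G \<longleftrightarrow>
    f \<in> auto G \<and> (\<forall>x\<in>carrier G. \<exists>z\<in>upper_central G i. f x = z \<otimes> x)"
proof -
  let ?Z = "upper_central G i"
  interpret Z: normal ?Z G by (rule assms)
  have "f \<in> Aut_ker i G \<longleftrightarrow> f \<in> auto G \<and> (\<forall>C\<in>carrier (G Mod ?Z). f ` C = C)"
    by (auto simp: Aut_ker_def kernel_def one_AutoGroup restrict_def fun_eq_iff)
  also have "(\<forall>C\<in>carrier (G Mod ?Z). f ` C = C) \<longleftrightarrow> (\<forall>x\<in>carrier G. f ` (?Z #> x) = ?Z #> x)"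
    by (auto simp: FactGroup_def RCOSETS_def)
  also have "f \<in> auto G \<and> \<dots> \<longleftrightarrow> f \<in> auto G \<and> (\<forall>x\<in>carrier G. \<exists>z\<in>?Z. f x = z \<otimes> x)"
  proof (intro conj_cong refl iffI ballI)
    fix x assume "\<forall>x\<in>carrier G. f ` (?Z #> x) = ?Z #> x" and x: "x \<in> carrier G"
    then have "f x \<in> ?Z #> x" using rcos_self[OF x Z.subgroup_axioms] by blast
    then show "\<exists>z\<in>?Z. f x = z \<otimes> x" by (auto simp: r_coset_def)
  next
    fix x assume f: "f \<in> auto G" and triv: "\<forall>x\<in>carrier G. \<exists>z\<in>?Z. f x = z \<otimes> x" and x: "x \<in> carrier G"
    have coset: "?Z #> f y = ?Z #> y" if "y \<in> carrier G" for y
      using triv that autoD(4)[OF f] by (simp add: Z.r_coset_eq_iff)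
    have self: "y \<in> ?Z #> x \<longleftrightarrow> y \<in> carrier G \<and> ?Z #> y = ?Z #> x" for y
      using x rcos_self[OF _ Z.subgroup_axioms] repr_independence[OF _ x Z.subgroup_axioms]
        r_coset_subset_G[OF Z.subset x] by blast
    show "f ` (?Z #> x) = ?Z #> x"
    proof (intro equalityI subsetI)
      fix y assume "y \<in> f ` (?Z #> x)"
      then show "y \<in> ?Z #> x" using coset autoD(4)[OF f] by (auto simp: self)
    next
      fix y assume y: "y \<in> ?Z #> x"
      then have "y \<in> f ` carrier G" using autoD(3)[OF f] by (simp add: self bij_betw_def)
      then obtain w where w: "w \<in> carrier G" "y = f w" by auto
      then have "w \<in> ?Z #> x" using y coset[OF w(1)] by (simp add: self)
      then show "y \<in> f ` (?Z #> x)" using w(2) by blast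
    qed
  qed
  finally show ?thesis .
qed

lemma subgroup_Aut_ker:
  assumes Z: "upper_central G i \<lhd> G"
  shows "subgroup (Aut_ker i G) (AutoGroup G)"
proof -
  interpret Z: normal "upper_central G i" G by (rule assms)
  interpret A: group "AutoGroup G" by (rule AutoGroup)
  note iff = Aut_ker_iff[OF Z]
  show ?thesis
  proof (rule A.subgroupI)
    show "Aut_ker i G \<subseteq> carrier (AutoGroup G)" by (auto simp: iff)
    have "\<one>\<^bsub>AutoGroup G\<^esub> \<in> Aut_ker i G"
      unfolding iff using A.one_closed Z.one_closed
      by (auto simp: one_AutoGroup intro!: bexI[of _ \<one>])
    then show "Aut_ker i G \<noteq> {}" by blast
  next
    fix f assume f: "f \<in> Aut_ker i G"
    then have fa: "f \<in> auto G" by (simp add: iff)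
    let ?g = "inv\<^bsub>AutoGroup G\<^esub> f"
    have ga: "?g \<in> auto G" using A.inv_closed[of f] fa by simp
    have "f (?g x) = x" if "x \<in> carrier G" for x
      using fun_cong[OF A.r_inv[of f], of x] fa ga that by (simp add: mult_AutoGroup one_AutoGroup compose_def)
    moreover have "\<exists>z\<in>upper_central G i. ?g x = z \<otimes> x" if "x = f (?g x)" "x \<in> carrier G" for x
    proof -
      have gx: "?g x \<in> carrier G" using autoD(4)[OF ga that(2)] .
      then obtain z where z: "z \<in> upper_central G i" "f (?g x) = z \<otimes> ?g x" using f iff by blast
      then have "z \<otimes> ?g x = x" using that(1) by simp
      then have "?g x = inv z \<otimes> x" using z(1) gx Z.subset cancel_inv(2)[of z "?g x"] by auto
      then show ?thesis using z(1) Z.m_inv_closed by blast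
    qed
    ultimately show "?g \<in> Aut_ker i G" using ga by (simp add: iff)
  next
    fix f g assume f: "f \<in> Aut_ker i G" and g: "g \<in> Aut_ker i G"
    then have fg: "f \<in> auto G" "g \<in> auto G" by (simp_all add: iff)
    have "\<exists>z\<in>upper_central G i. f (g x) = z \<otimes> x" if x: "x \<in> carrier G" for x
    proof -
      obtain z where z: "z \<in> upper_central G i" "g x = z \<otimes> x" using g x iff by blast
      obtain w where w: "w \<in> upper_central G i" "f (g x) = w \<otimes> g x"
        using f autoD(4)[OF fg(2) x] iff by blast
      have "f (g x) = (w \<otimes> z) \<otimes> x" using x z w Z.subset by (auto simp: m_assoc)
      then show ?thesis using Z.m_closed[OF w(1) z(1)] by blast
    qed
    then show "f \<otimes>\<^bsub>AutoGroup G\<^esub> g \<in> Aut_ker i G"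
      using A.m_closed[of f g] fg by (simp add: iff mult_AutoGroup compose_def)
  qed
qed

lemma Inn_subset_auto: "Inn G \<subseteq> auto G"
proof
  fix f assume "f \<in> Inn G"
  then obtain g where g: "g \<in> carrier G" "f = (\<lambda>x\<in>carrier G. conjugate G x g)" by (auto simp: Inn_def)
  have "f \<in> hom G G"
    using g by (auto simp: hom_def conjugate_def m_assoc)
  moreover have "bij_betw f (carrier G) (carrier G)"
    by (rule bij_betw_byWitness[where f' = "\<lambda>x. conjugate G x (inv g)"])
       (use g in \<open>auto simp: conjugate_def m_assoc\<close>)
  ultimately show "f \<in> auto G" using g by (simp add: auto_def Bij_def)
qed

text \<open>In a group of class two, conjugation by \<open>g k n\<close> multiplies \<open>x\<close> by \<open>z [^] (- k)\<close> and \<open>y\<close> by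
  \<open>z [^] (- n)\<close>: powers of the commutator can be prescribed independently on two generators.\<close>

lemma class2_conjugation:
  assumes xyz: "x \<in> carrier G" "y \<in> carrier G" "z \<in> carrier G"
    and rel: "y \<otimes> x = x \<otimes> y \<otimes> z" "z \<otimes> x = x \<otimes> z" "z \<otimes> y = y \<otimes> z"
  defines "g \<equiv> \<lambda>k n. y [^] (k :: int) \<otimes> x [^] (- n :: int)"
  shows "g k n \<otimes> (z [^] (- k) \<otimes> x) = x \<otimes> g k n" "g k n \<otimes> (z [^] (- n) \<otimes> y) = y \<otimes> g k n"
proof -
  have zpow: "z [^] i \<otimes> x [^] j = x [^] j \<otimes> z [^] i" "z [^] i \<otimes> y [^] j = y [^] j \<otimes> z [^] i" for i j :: int
    using int_pow_commute[of x "z [^] i" j] int_pow_commute[of y "z [^] i" j]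
      int_pow_commute[of z x i] int_pow_commute[of z y i] xyz rel(2,3) by simp_all
  have "g k n \<otimes> (z [^] (- k) \<otimes> x) = y [^] k \<otimes> (x [^] (- n) \<otimes> z [^] (- k)) \<otimes> x"
    using xyz by (simp add: g_def m_assoc)
  also have "x [^] (- n) \<otimes> z [^] (- k) = z [^] (- k) \<otimes> x [^] (- n)" by (rule zpow(1)[symmetric])
  also have "y [^] k \<otimes> (z [^] (- k) \<otimes> x [^] (- n)) \<otimes> x = y [^] k \<otimes> z [^] (- k) \<otimes> (x [^] (- n) \<otimes> x)"
    using xyz by (simp add: m_assoc)
  also have "x [^] (- n) \<otimes> x = x \<otimes> x [^] (- n)" using xyz by (simp add: int_pow_commute)
  also have "y [^] k \<otimes> z [^] (- k) = z [^] (- k) \<otimes> y [^] k" by (rule zpow(2)[symmetric])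
  also have "z [^] (- k) \<otimes> y [^] k \<otimes> (x \<otimes> x [^] (- n)) = z [^] (- k) \<otimes> (y [^] k \<otimes> x) \<otimes> x [^] (- n)"
    using xyz by (simp add: m_assoc)
  also have "y [^] k \<otimes> x = x \<otimes> y [^] k \<otimes> z [^] k"
    using class2_swap[OF xyz rel, of k 1] xyz(1) by simp
  also have "\<dots> = x \<otimes> (z [^] k \<otimes> y [^] k)" using xyz by (simp add: m_assoc zpow(2))
  also have "\<dots> = z [^] k \<otimes> (x \<otimes> y [^] k)"
    using zpow(1)[of k 1] xyz by (simp flip: m_assoc)
  also have "z [^] (- k) \<otimes> (z [^] k \<otimes> (x \<otimes> y [^] k)) \<otimes> x [^] (- n) = x \<otimes> g k n"
    using xyz by (simp add: g_def m_assoc int_pow_neg)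
  finally show "g k n \<otimes> (z [^] (- k) \<otimes> x) = x \<otimes> g k n" .
  have "y \<otimes> x [^] (- n) = x [^] (- n) \<otimes> y \<otimes> z [^] (- n)"
    using class2_swap[OF xyz rel, of 1 "- n"] xyz(2) by simp
  then have 1: "x [^] (- n) \<otimes> (z [^] (- n) \<otimes> y) = y \<otimes> x [^] (- n)"
    using zpow(2)[of "- n" 1] xyz by (simp add: m_assoc)
  have "g k n \<otimes> (z [^] (- n) \<otimes> y) = y [^] k \<otimes> (x [^] (- n) \<otimes> (z [^] (- n) \<otimes> y))"
    using xyz by (simp add: g_def m_assoc)
  also have "\<dots> = (y [^] k \<otimes> y) \<otimes> x [^] (- n)" unfolding 1 using xyz by (simp add: m_assoc)
  also have "y [^] k \<otimes> y = y \<otimes> y [^] k" using xyz by (simp add: int_pow_commute)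
  finally show "g k n \<otimes> (z [^] (- n) \<otimes> y) = y \<otimes> g k n" using xyz by (simp add: g_def m_assoc)
qed

end

context macdonald_quotient
begin

abbreviation "Z2 \<equiv> upper_central K 2"
abbreviation "Aut2 \<equiv> Aut_ker 2 K"
abbreviation "Aut1 \<equiv> Aut_ker 1 K"

lemma degree_inv:
  assumes "x \<in> carrier K"
  shows "degree_a (inv x) = (- degree_a x) mod M" "degree_b (inv x) = (- degree_b x) mod M"
  using degree_pow[OF assms, of "- 1"] assms by (simp_all add: int_pow_neg)

lemma degree_conj:
  assumes "x \<in> carrier K" "h \<in> carrier K"
  shows "degree_a (x \<otimes> h \<otimes> inv x) = degree_a h" "degree_b (x \<otimes> h \<otimes> inv x) = degree_b h"
  using assms degree_range[OF assms(2)] by (simp_all add: degree_mult degree_inv mod_simps)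

lemma normal_Z2: "Z2 \<lhd> K"
  unfolding normal_inv_iff
proof (intro conjI ballI)
  show "subgroup Z2 K"
    by (rule subgroupI)
       (auto simp: upper_central_2_eq degree_mult degree_inv intro!: exI[of _ c] simp: degree_commutator)
qed (simp add: upper_central_2_eq degree_conj)

text \<open>Acting trivially on a quotient can be tested on the generators.\<close>

lemma hom_trivial_mod:
  assumes "H \<lhd> K" and f: "f \<in> hom K K"
    and ab: "u \<in> H" "f a = u \<otimes> a" "v \<in> H" "f b = v \<otimes> b" and x: "x \<in> carrier K"
  shows "\<exists>z\<in>H. f x = z \<otimes> x"
proof -
  interpret H: normal H K by (rule assms(1))
  interpret f: group_hom K K f by (intro group_hom.intro group_hom_axioms.intro group_axioms f)
  have step: "\<exists>z\<in>H. f (x \<otimes> y) = z \<otimes> (x \<otimes> y)"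
    if x: "x \<in> carrier K" "y \<in> carrier K" and zx: "z \<in> H" "f x = z \<otimes> x" and w: "w \<in> H" "f y = w \<otimes> y"
    for x y z w
  proof -
    have "f (x \<otimes> y) = z \<otimes> (x \<otimes> w \<otimes> inv x) \<otimes> (x \<otimes> y)"
      using x zx w H.subset by (auto simp: m_assoc subset_iff)
    moreover have "z \<otimes> (x \<otimes> w \<otimes> inv x) \<in> H" using x(1) zx(1) w(1) H.inv_op_closed2 by blast
    ultimately show ?thesis by blast
  qed
  show ?thesis
    using x
  proof (induction rule: generator_induct)
    case one
    then show ?case by (intro bexI[of _ \<one>]) simp_all
  next
    case (a x)
    then show ?case using step[of x a] ab by blast
  next
    case (b x)
    then show ?case using step[of x b] ab by blast
  qed
qed

lemma finite_carrier: "finite (carrier K)"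
proof (rule finite_surj)
  show "finite ({0..<N} \<times> {0..<N} \<times> {0..<S})" by simp
  show "carrier K \<subseteq> (\<lambda>(i, j, k). a [^] i \<otimes> b [^] j \<otimes> c [^] k) ` ({0..<N} \<times> {0..<N} \<times> {0..<S})"
  proof
    fix g assume "g \<in> carrier K"
    then obtain i j k :: int where g: "g = a [^] i \<otimes> b [^] j \<otimes> c [^] k" using normal_form by metis
    have "a [^] i = a [^] (i mod N)" "b [^] j = b [^] (j mod N)"
      by (rule a_pow_cong b_pow_cong; simp add: minus_mod_eq_mult_div)+
    moreover have "c [^] k = c [^] (k mod S)"
      using c_pow_dvd[of "k - k mod S"] int_pow_mult[of c "k - k mod S" "k mod S"]
      by (simp add: minus_mod_eq_mult_div)
    ultimately have "g = a [^] (i mod N) \<otimes> b [^] (j mod N) \<otimes> c [^] (k mod S)" using g by simp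
    moreover have "S > 0" by (simp add: S_def)
    ultimately show "g \<in> (\<lambda>(i, j, k). a [^] i \<otimes> b [^] j \<otimes> c [^] k) ` ({0..<N} \<times> {0..<N} \<times> {0..<S})"
      using N_pos by (auto intro!: image_eqI[of _ _ "(i mod N, j mod N, k mod S)"])
  qed
qed

text \<open>The relations give an endomorphism. Its image contains the generators, so it is onto, and
  since \<open>K\<close> is finite it is bijective.\<close>

lemma Aut2_exists:
  assumes xy: "x \<in> carrier K" "y \<in> carrier K" and "macdonald_relations K m l x y"
    and "a \<in> generate K {x, y}" "b \<in> generate K {x, y}"
    and "x \<otimes> inv a \<in> Z2" "y \<otimes> inv b \<in> Z2"
  shows "\<exists>f\<in>Aut2. f a = x \<and> f b = y"
proof -
  obtain h where h: "h \<in> hom K K" "h a = x" "h b = y" using endomorphism assms(1-3) by blast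
  interpret h: group_hom K K h by (intro group_hom.intro group_hom_axioms.intro group_axioms h(1))
  define f where "f = restrict h (carrier K)"
  have f_hom: "f \<in> hom K K" using h(1) by (auto simp: f_def hom_def)
  have fab: "f a = x" "f b = y" by (simp_all add: f_def h(2,3))
  have "generate K {x, y} = h ` carrier K"
    using h.generate_img[of "{a, b}"] by (simp add: generated h(2,3))
  moreover have "generate K {a, b} \<subseteq> generate K {x, y}"
    using assms(4,5) by (intro generate_subgroup_incl generate_is_subgroup) (use xy in auto)
  ultimately have surj: "f ` carrier K = carrier K" by (auto simp: f_def generated)
  then have "inj_on f (carrier K)" by (rule finite_surj_inj[OF finite_carrier, OF equalityD2])
  with surj have "f \<in> auto K" using f_hom by (simp add: auto_def Bij_def bij_betw_def f_def)
  moreover have "\<forall>g\<in>carrier K. \<exists>z\<in>Z2. f g = z \<otimes> g"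
    using hom_trivial_mod[OF normal_Z2 f_hom assms(6) _ assms(7)] xy by (simp add: fab m_assoc)
  ultimately show ?thesis using fab by (auto simp: Aut_ker_iff[OF normal_Z2])
qed

text \<open>Replacing \<open>a\<close> by an element \<open>x\<close> for which \<open>[x, b]\<close> differs from \<open>c\<close> by a central factor does not
  affect conjugation by the commutator; only the order of that factor and the relations for \<open>x\<close> itself
  remain to be checked.\<close>

lemma relations_of_central_twist:
  assumes x: "x \<in> carrier K" and z: "z \<in> group_center K" "z [^] S = \<one>"
    and comm: "commutator K x b = c \<otimes> z"
    and "inv c \<otimes> x \<otimes> c = x [^] (1 + M * l)" "x [^] N = \<one>"
  shows "macdonald_relations K m l x b"
proof -
  note zc = group_centerD(1)[OF z(1)]
  have zi: "inv z \<in> group_center K" using subgroup.m_inv_closed[OF subgroup_group_center z(1)] .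
  have "inv (c \<otimes> z) \<otimes> x \<otimes> (c \<otimes> z) = inv z \<otimes> (inv c \<otimes> x \<otimes> c) \<otimes> z"
    using x zc by (simp add: inv_mult_group m_assoc)
  also have "\<dots> = inv c \<otimes> x \<otimes> c" using x zc by (simp add: group_centerD(2)[OF zi] m_assoc)
  finally have 1: "inv (c \<otimes> z) \<otimes> x \<otimes> (c \<otimes> z) = x [^] (1 + M * l)" using assms(5) by simp
  have "c \<otimes> z \<otimes> b \<otimes> inv (c \<otimes> z) = c \<otimes> (z \<otimes> b) \<otimes> inv z \<otimes> inv c"
    using zc by (simp add: inv_mult_group m_assoc)
  also have "z \<otimes> b = b \<otimes> z" by (rule group_centerD(2)[OF z(1)]) simp
  also have "c \<otimes> (b \<otimes> z) \<otimes> inv z \<otimes> inv c = c \<otimes> b \<otimes> inv c" using zc by (simp add: m_assoc)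
  also have "\<dots> = b [^] (1 + M * l)" using relations by (simp add: macdonald_relations_iff M_def)
  finally have 2: "c \<otimes> z \<otimes> b \<otimes> inv (c \<otimes> z) = b [^] (1 + M * l)" .
  have "(c \<otimes> z) [^] S = \<one>"
    using int_pow_mult_distrib[of c z S] group_centerD(2)[OF z(1), of c] zc z(2) c_order by simp
  then show ?thesis
    using 1 2 x assms(6) b_pow_dvd[of N]
    by (simp add: macdonald_relations_iff comm M_def N_def S_def)
qed

lemma N_dvd_M_triangular: "N dvd M * t * triangular (M * s)"
proof -
  have "2 * triangular (M * s) = 2 * (S * (s * (M * s - 1)))"
    by (simp add: two_triangular M_eq)
  then show ?thesis by (intro N_dvd_M_S) simp
qed

text \<open>Here \<open>[a [^] (1 + S), b]\<close> is \<open>c\<close> times a power of \<open>a [^] M\<close>, and the relations for \<open>a\<close> pass to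
  its powers.\<close>

lemma Aut2_power:
  "\<exists>f\<in>Aut2. f a = a [^] (1 + S) \<and> f b = b"
proof (rule Aut2_exists)
  let ?x = "a [^] (1 + S)" and ?z = "a [^] (M * (- l * triangular (1 + S)))"
  show "macdonald_relations K m l ?x b"
  proof (rule relations_of_central_twist)
    show "?z \<in> group_center K" by (rule a_pow_M_central)
    have "N dvd M * (- l * triangular (1 + S)) * S" by (simp add: N_eq mult.assoc mult.left_commute[of S])
    then show "?z [^] S = \<one>" unfolding int_pow_pow[OF a] by (rule a_pow_dvd)
    have "commutator K ?x b = inv ?x \<otimes> (inv b \<otimes> ?x \<otimes> b)" by (simp add: commutator_def m_assoc)
    also have "\<dots> = c [^] (1 + S) \<otimes> ?z" by (subst conj_b_a_pow) (simp add: m_assoc mult.assoc)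
    also have "c [^] (1 + S) = c" by (simp add: int_pow_mult c_order)
    finally show "commutator K ?x b = c \<otimes> ?z" .
    show "inv c \<otimes> ?x \<otimes> c = ?x [^] (1 + M * l)"
      unfolding conj_c_a_pow by (simp add: int_pow_pow mult.commute)
    show "?x [^] N = \<one>" by (simp add: int_pow_pow a_pow_dvd)
  qed simp
  show "b \<in> generate K {?x, b}" by (rule generate.incl) simp
  \<comment> \<open>Since \<open>N\<close> divides the fourth power of \<open>S\<close>, the inverse of \<open>1 + S\<close> modulo \<open>N\<close> is
    \<open>(1 - S) * (1 + S * S)\<close>; so \<open>a\<close> is a power of its image.\<close>
  have "even (S * S)" using even_S by simp
  then obtain t where t: "S * S = 2 * t" by (auto elim: dvdE)
  have "(1 + S) * ((1 - S) * (1 + S * S)) = 1 - (S * S) * (S * S)" by (simp add: algebra_simps)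
  also have "\<dots> = 1 - N * t" by (simp add: N_eq M_eq) (simp add: t)
  finally have "N dvd (1 + S) * ((1 - S) * (1 + S * S)) - 1" by simp
  then have "?x [^] ((1 - S) * (1 + S * S)) = a [^] (1 :: int)"
    unfolding int_pow_pow[OF a] by (rule a_pow_cong)
  moreover have "?x [^] i \<in> generate K {?x, b}" for i :: int
    by (rule subgroup_int_pow_closed[OF generate_is_subgroup]) (auto intro: generate.incl)
  ultimately show "a \<in> generate K {?x, b}" by (metis a int_pow_1)
  show "?x \<otimes> inv a \<in> Z2"
    by (simp add: upper_central_2_eq degree_mult degree_inv degree_pow degree_generators mod_simps)
  show "b \<otimes> inv b \<in> Z2" by (simp add: subgroup.one_closed[OF normal_imp_subgroup[OF normal_Z2]])
qed auto

text \<open>Multiplying \<open>a\<close> by a power of \<open>b\<close> that commutes with \<open>c\<close> does not change \<open>[a, b]\<close>. As \<open>b [^] S\<close>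
  commutes with \<open>a\<close> up to a central factor, the formula for powers in class two gives
  \<open>x [^] (M * t) = a [^] (M * t)\<close> for \<open>x = a \<otimes> b [^] S\<close>, and with it the relations for \<open>x\<close>.\<close>

lemma Aut2_transvection:
  "\<exists>f\<in>Aut2. f a = a \<otimes> b [^] S \<and> f b = b"
proof (rule Aut2_exists)
  let ?x = "a \<otimes> b [^] S"
  let ?z = "b [^] (M * (- l * triangular S))"
  have z: "?z \<in> group_center K" by (rule b_pow_M_central)
  have "inv a \<otimes> b [^] S \<otimes> a = b [^] S \<otimes> ?z"
    using conj_a_b_pow[of S] by (simp add: c_order int_pow_neg mult.assoc)
  then have "b [^] S \<otimes> a = a \<otimes> (b [^] S \<otimes> ?z)" by (subst (asm) conj_eq_iff) simp_all
  then have swap: "b [^] S \<otimes> a = a \<otimes> b [^] S \<otimes> ?z" by (simp add: m_assoc)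
  have xM: "?x [^] (M * t) = a [^] (M * t)" for t
  proof -
    have "?x [^] (M * t) = a [^] (M * t) \<otimes> (b [^] S) [^] (M * t) \<otimes> ?z [^] triangular (M * t)"
      by (rule class2_power) (use swap group_centerD(2)[OF z] in auto)
    also have "(b [^] S) [^] (M * t) = \<one>"
      unfolding int_pow_pow[OF b] by (rule b_pow_dvd) (simp add: N_eq mult.left_commute)
    also have "?z [^] triangular (M * t) = \<one>"
      unfolding int_pow_pow[OF b] by (rule b_pow_dvd) (rule N_dvd_M_triangular)
    finally show ?thesis by simp
  qed
  have c_bS: "c \<otimes> b [^] S = b [^] S \<otimes> c"
    using c_pow_b_pow[of 1 S] b_pow_dvd[of "M * l * S"] by (simp add: N_eq mult.commute mult.left_commute)
  show "macdonald_relations K m l ?x b"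
  proof (rule relations_of_central_twist)
    show "\<one> \<in> group_center K" by (rule subgroup.one_closed[OF subgroup_group_center])
    have "b [^] S \<otimes> b = b \<otimes> b [^] S" by (simp add: int_pow_commute)
    then have "commutator K ?x b = inv (b [^] S) \<otimes> (c \<otimes> b [^] S)"
      by (simp add: commutator_def inv_mult_group m_assoc)
    then show "commutator K ?x b = c \<otimes> \<one>" by (simp add: c_bS)
    have "inv c \<otimes> ?x \<otimes> c = inv c \<otimes> a \<otimes> (b [^] S \<otimes> c)" by (simp add: m_assoc)
    also have "\<dots> = inv c \<otimes> a [^] (1 :: int) \<otimes> c \<otimes> b [^] S" by (simp add: m_assoc flip: c_bS)
    also have "\<dots> = a [^] (M * l) \<otimes> ?x"
      unfolding conj_c_a_pow using int_pow_mult[of a "M * l" 1] by (simp add: m_assoc add.commute)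
    also have "\<dots> = ?x \<otimes> a [^] (M * l)" by (rule a_pow_M_commute) simp
    also have "\<dots> = ?x [^] (1 + M * l)" using int_pow_mult[of ?x 1 "M * l"] by (simp add: xM)
    finally show "inv c \<otimes> ?x \<otimes> c = ?x [^] (1 + M * l)" .
    show "?x [^] N = \<one>" using xM[of S] a_order by (simp add: N_eq)
  qed auto
  show b: "b \<in> generate K {?x, b}" by (rule generate.incl) simp
  have "?x \<in> generate K {?x, b}" by (rule generate.incl) simp
  moreover have "b [^] (- S) \<in> generate K {?x, b}"
    by (rule subgroup_int_pow_closed[OF generate_is_subgroup b]) auto
  ultimately have "?x \<otimes> b [^] (- S) \<in> generate K {?x, b}" by (rule generate.eng)
  then show "a \<in> generate K {?x, b}" by (simp add: m_assoc int_pow_neg)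
  show "?x \<otimes> inv a \<in> Z2"
    by (simp add: upper_central_2_eq degree_mult degree_inv degree_pow degree_generators mod_simps)
  show "b \<otimes> inv b \<in> Z2" by (simp add: subgroup.one_closed[OF normal_imp_subgroup[OF normal_Z2]])
qed auto

end

section \<open>Matrices modulo two\<close>

lemma (in group_hom) generate_FactGroup_kernel:
  assumes T: "T \<subseteq> carrier G" and onto: "\<And>d. d \<in> carrier H \<Longrightarrow> \<exists>f\<in>generate G T. h f = d"
  shows "generate (G Mod kernel G H h) ((\<lambda>x. kernel G H h #> x) ` T) = carrier (G Mod kernel G H h)"
proof -
  let ?N = "kernel G H h"
  interpret N: normal ?N G by (rule normal_kernel)
  interpret q: group_hom G "G Mod ?N" "\<lambda>x. ?N #> x"
    by (intro group_hom.intro group_hom_axioms.intro G.group_axioms N.factorgroup_is_group N.r_coset_hom_Mod)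
  have "C \<in> (\<lambda>x. ?N #> x) ` generate G T" if C: "C \<in> carrier (G Mod ?N)" for C
  proof -
    obtain f where f: "f \<in> carrier G" "C = ?N #> f" using C by (auto simp: FactGroup_def RCOSETS_def)
    obtain g where g: "g \<in> generate G T" "h g = h f" using onto[OF hom_closed[OF f(1)]] by blast
    have gG: "g \<in> carrier G" using g(1) G.generate_incl[OF T] by auto
    have "h (f \<otimes> inv g) = \<one>\<^bsub>H\<^esub>"
      using f(1) gG by (simp only: hom_mult hom_inv G.inv_closed g(2) H.r_inv hom_closed)
    then have "f \<otimes> inv g \<in> ?N"
      using f(1) gG by (simp only: kernel_def mem_Collect_eq G.m_closed G.inv_closed)
    moreover have "f = f \<otimes> inv g \<otimes> g" using f(1) gG by (simp only: G.m_assoc G.l_inv G.r_one G.inv_closed)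
    ultimately have "\<exists>z\<in>?N. f = z \<otimes> g" by (rule bexI[rotated])
    then have "?N #> f = ?N #> g" by (rule iffD2[OF N.r_coset_eq_iff[OF f(1) gG]])
    then show ?thesis using f(2) g(1) by blast
  qed
  then have "carrier (G Mod ?N) \<subseteq> generate (G Mod ?N) ((\<lambda>x. ?N #> x) ` T)"
    unfolding q.generate_img[OF T, symmetric] by blast
  moreover have "generate (G Mod ?N) ((\<lambda>x. ?N #> x) ` T) \<subseteq> carrier (G Mod ?N)"
    by (rule q.H.generate_incl) (use T in \<open>auto simp: FactGroup_def RCOSETS_def\<close>)
  ultimately show ?thesis by blast
qed

lemma less_4_iff: "i < 4 \<longleftrightarrow> i = 0 \<or> i = 1 \<or> i = 2 \<or> i = (3 :: nat)"
  by auto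

lemma all_less_4_iff: "(\<forall>i\<in>{..<4 :: nat}. P i) \<longleftrightarrow> P 0 \<and> P 1 \<and> P 2 \<and> P 3"
  by (auto simp: less_4_iff)

text \<open>The additive group of two by two matrices over the field with two elements, as vectors of length
  four.\<close>

abbreviation (input) "bits \<equiv> direct_power (integer_mod_group 2) 4"

definition unit_vector :: "nat \<Rightarrow> nat \<Rightarrow> int" where
  "unit_vector i = (\<lambda>j\<in>{..<4}. if j = i then 1 else 0)"

lemma generate_unit_vectors:
  assumes h: "group_hom G bits h" and T: "\<psi> ` {..<4} \<subseteq> carrier G"
    and unit: "\<And>i. i < 4 \<Longrightarrow> h (\<psi> i) = unit_vector i" and d: "d \<in> carrier bits"
  shows "\<exists>f\<in>generate G (\<psi> ` {..<4}). h f = d"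
proof -
  interpret h: group_hom G bits h by (rule h)
  define p where "p i = (if d i = 1 then \<psi> i else \<one>\<^bsub>G\<^esub>)" for i
  have d01: "d i = 0 \<or> d i = 1" if "i < 4" for i
  proof -
    have "d i \<in> {0..<2}" using d that by (auto simp: carrier_integer_mod_group PiE_iff)
    then show ?thesis by auto
  qed
  have hp: "h (p i) = (\<lambda>j\<in>{..<4}. if j = i then d i else 0)" if "i < 4" for i
    using unit[OF that] d01[OF that] by (auto simp: p_def unit_vector_def)
  have gen: "p i \<in> generate G (\<psi> ` {..<4})" if "i < 4" for i
    using that by (auto simp: p_def intro: generate.incl generate.one)
  have carr: "p i \<in> carrier G" if "i < 4" for i
    using gen[OF that] h.G.generate_incl[OF T] by auto
  have "h (p 0 \<otimes>\<^bsub>G\<^esub> p 1 \<otimes>\<^bsub>G\<^esub> p 2 \<otimes>\<^bsub>G\<^esub> p 3) = d"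
  proof (rule PiE_ext)
    show "d \<in> (\<Pi>\<^sub>E i\<in>{..<4}. carrier (integer_mod_group 2))" using d by simp
    show "h (p 0 \<otimes>\<^bsub>G\<^esub> p 1 \<otimes>\<^bsub>G\<^esub> p 2 \<otimes>\<^bsub>G\<^esub> p 3) \<in> (\<Pi>\<^sub>E i\<in>{..<4}. carrier (integer_mod_group 2))"
      using h.hom_closed[of "p 0 \<otimes>\<^bsub>G\<^esub> p 1 \<otimes>\<^bsub>G\<^esub> p 2 \<otimes>\<^bsub>G\<^esub> p 3"] carr by simp
    have "h (p 0 \<otimes>\<^bsub>G\<^esub> p 1 \<otimes>\<^bsub>G\<^esub> p 2 \<otimes>\<^bsub>G\<^esub> p 3)
      = h (p 0) \<otimes>\<^bsub>bits\<^esub> h (p 1) \<otimes>\<^bsub>bits\<^esub> h (p 2) \<otimes>\<^bsub>bits\<^esub> h (p 3)"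
      using carr[of 0] carr[of 1] carr[of 2] carr[of 3] by (simp only: h.hom_mult h.G.m_closed)
    moreover fix i assume i: "i \<in> {..<4::nat}"
    have mult: "(u \<otimes>\<^bsub>bits\<^esub> v) i = (u i + v i) mod 2" for u v :: "nat \<Rightarrow> int"
      using i by simp
    have hpi: "h (p j) i = (if i = j then d j else 0)" if "j < 4" for j
      using hp[OF that] i by simp
    ultimately have "h (p 0 \<otimes>\<^bsub>G\<^esub> p 1 \<otimes>\<^bsub>G\<^esub> p 2 \<otimes>\<^bsub>G\<^esub> p 3) i = ((((if i = 0 then d 0 else 0)
      + (if i = 1 then d 1 else 0)) mod 2 + (if i = 2 then d 2 else 0)) mod 2 + (if i = 3 then d 3 else 0)) mod 2"
      by (simp only: mult hpi[of 0, simplified] hpi[of 1, simplified] hpi[of 2, simplified] hpi[of 3, simplified] One_nat_def)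
    also have "\<dots> = d i mod 2"
      using i unfolding lessThan_iff less_4_iff by (elim disjE) simp_all
    also have "\<dots> = d i" using i d01[of i] by auto
    finally show "h (p 0 \<otimes>\<^bsub>G\<^esub> p 1 \<otimes>\<^bsub>G\<^esub> p 2 \<otimes>\<^bsub>G\<^esub> p 3) i = d i" .
  qed
  moreover have "p 0 \<otimes>\<^bsub>G\<^esub> p 1 \<otimes>\<^bsub>G\<^esub> p 2 \<otimes>\<^bsub>G\<^esub> p 3 \<in> generate G (\<psi> ` {..<4})"
    by (intro generate.eng gen) auto
  ultimately show ?thesis by blast
qed

context macdonald_quotient
begin

lemma degree_half:
  assumes "x \<in> Z2"
  shows "degree_a x div S \<in> {0..<2}" "degree_b x div S \<in> {0..<2}"
    "degree_a x div S = 0 \<longleftrightarrow> degree_a x = 0" "degree_b x div S = 0 \<longleftrightarrow> degree_b x = 0"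
proof -
  have pos: "S > 0" by (simp add: S_def)
  have *: "t div S \<in> {0..<2}" "t div S = 0 \<longleftrightarrow> t = 0" if t: "S dvd t" "t \<in> {0..<M}" for t
  proof -
    obtain k where k: "t = S * k" using t(1) by (auto elim: dvdE)
    have "S * k < S * 2" "S * 0 \<le> S * k" using t(2) unfolding k M_eq by (simp_all only: atLeastLessThan_iff mult.commute[of S 2] mult_zero_right)
    then have "k < 2" "0 \<le> k" using mult_less_cancel_left_pos[OF pos] mult_le_cancel_left_pos[OF pos] by blast+
    then have "k \<in> {0..<2}" by simp
    then show "t div S \<in> {0..<2}" "t div S = 0 \<longleftrightarrow> t = 0" using pos by (simp_all add: k)
  qed
  show "degree_a x div S \<in> {0..<2}" "degree_b x div S \<in> {0..<2}"
    "degree_a x div S = 0 \<longleftrightarrow> degree_a x = 0" "degree_b x div S = 0 \<longleftrightarrow> degree_b x = 0"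
    using assms by (auto simp only: upper_central_2_eq mem_Collect_eq intro!: * degree_range)
qed

lemma degree_half_mult:
  assumes "x \<in> Z2" "y \<in> Z2"
  shows "degree_a (x \<otimes> y) div S = (degree_a x div S + degree_a y div S) mod 2"
    "degree_b (x \<otimes> y) div S = (degree_b x div S + degree_b y div S) mod 2"
proof -
  have S0: "S \<noteq> 0" by (simp add: S_def)
  have *: "(t + u) mod M div S = (t div S + u div S) mod 2" if tu: "S dvd t" "S dvd u" for t u
  proof -
    obtain p q where "t = S * p" "u = S * q" using tu by (auto elim!: dvdE)
    moreover have "(S * p + S * q) mod M = S * ((p + q) mod 2)"
      by (simp add: M_eq mult_mod_right distrib_left mult.commute[of 2])
    ultimately show ?thesis using S0 by simp
  qed
  show "degree_a (x \<otimes> y) div S = (degree_a x div S + degree_a y div S) mod 2"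
    "degree_b (x \<otimes> y) div S = (degree_b x div S + degree_b y div S) mod 2"
    using assms by (simp_all add: upper_central_2_eq degree_mult * )
qed

text \<open>For a pair \<open>v\<close> in the second centre all degrees are \<open>0\<close> or \<open>S\<close> modulo \<open>M = 2 * S\<close>. Dividing them by
  \<open>S\<close> gives the entries of a matrix over the field with two elements, listed in the order of the four
  generating automorphisms.\<close>

definition digits :: "(nat \<Rightarrow> 'k) \<Rightarrow> nat \<Rightarrow> int" where
  "digits v = (\<lambda>i\<in>{..<4}. [degree_a (v 0), degree_b (v 1), degree_b (v 0), degree_a (v 1)] ! i div S)"

text \<open>An automorphism \<open>f\<close> acts on the abelianization by a matrix. If \<open>f\<close> acts trivially modulo the second
  centre, this matrix is \<open>1 + S * X\<close>, and \<open>X\<close> consists of the digits of the displacement of the two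
  generators.\<close>

definition displacement :: "('k \<Rightarrow> 'k) \<Rightarrow> nat \<Rightarrow> 'k" where
  "displacement f = (\<lambda>i\<in>{..<2}. (if i = 0 then f a \<otimes> inv a else f b \<otimes> inv b))"

abbreviation "Z2_squared \<equiv> direct_power (K\<lparr>carrier := Z2\<rparr>) 2"
abbreviation "Z1c \<equiv> upper_central K 1 <#> generate K {c}"
abbreviation "Z1c_squared \<equiv> direct_power (K\<lparr>carrier := Z1c\<rparr>) 2"

lemma Z2_squared_carrier:
  "v \<in> carrier Z2_squared \<Longrightarrow> v 0 \<in> Z2 \<and> v 1 \<in> Z2"
  by (auto simp: PiE_iff)

lemma digits_in_bits: "v 0 \<in> Z2 \<Longrightarrow> v 1 \<in> Z2 \<Longrightarrow> digits v \<in> carrier bits"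
  using degree_half[of "v 0"] degree_half[of "v 1"]
  by (auto simp: digits_def carrier_integer_mod_group less_4_iff)

lemma digits_mult:
  assumes "v 0 \<in> Z2" "v 1 \<in> Z2" "w 0 \<in> Z2" "w 1 \<in> Z2"
    and "u 0 = v 0 \<otimes> w 0" "u 1 = v 1 \<otimes> w 1"
  shows "digits u = digits v \<otimes>\<^bsub>bits\<^esub> digits w"
  using assms by (auto simp: digits_def less_4_iff degree_half_mult intro!: restrict_ext)

lemma digits_eq_one_iff:
  assumes "v 0 \<in> Z2" "v 1 \<in> Z2"
  shows "digits v = \<one>\<^bsub>bits\<^esub> \<longleftrightarrow> v 0 \<in> Z1c \<and> v 1 \<in> Z1c"
proof -
  have "digits v = \<one>\<^bsub>bits\<^esub> \<longleftrightarrow> (\<forall>i\<in>{..<4}. digits v i = 0)"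
    by (auto simp: digits_def fun_eq_iff)
  also have "\<dots> \<longleftrightarrow> degree_a (v 0) = 0 \<and> degree_b (v 1) = 0 \<and> degree_b (v 0) = 0 \<and> degree_a (v 1) = 0"
    using degree_half(3,4)[OF assms(1)] degree_half(3,4)[OF assms(2)]
    unfolding all_less_4_iff by (simp add: digits_def)
  also have "\<dots> \<longleftrightarrow> v 0 \<in> Z1c \<and> v 1 \<in> Z1c"
    using assms unfolding center_times_c_eq by (auto simp: upper_central_2_eq)
  finally show ?thesis .
qed

lemma group_bits: "group bits"
  by simp

lemma group_Z2_squared: "group Z2_squared"
  by (rule product_group) (rule subgroup_imp_group[OF normal_imp_subgroup[OF normal_Z2]])

lemma digits_hom: "group_hom Z2_squared bits digits"
proof (intro group_hom.intro group_hom_axioms.intro group_Z2_squared group_bits homI)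
  fix v w assume "v \<in> carrier Z2_squared" "w \<in> carrier Z2_squared"
  then show "digits (v \<otimes>\<^bsub>Z2_squared\<^esub> w) = digits v \<otimes>\<^bsub>bits\<^esub> digits w"
    using Z2_squared_carrier[of v] Z2_squared_carrier[of w] by (intro digits_mult) auto
qed (use Z2_squared_carrier digits_in_bits in blast)

lemma digits_surj: "digits ` carrier Z2_squared = carrier bits"
proof
  interpret digits: group_hom Z2_squared bits digits by (rule digits_hom)
  show "digits ` carrier Z2_squared \<subseteq> carrier bits"
    using digits.hom_closed by blast
  show "carrier bits \<subseteq> digits ` carrier Z2_squared"
  proof
    fix d assume d: "d \<in> carrier bits"
    define v where "v = (\<lambda>i\<in>{..<2::nat}. if i = 0 then a [^] (S * d 0) \<otimes> b [^] (S * d 2)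
       else a [^] (S * d 3) \<otimes> b [^] (S * d 1))"
    have S0: "S > 0" by (simp add: S_def)
    have d01: "d i \<in> {0, 1}" if "i < 4" for i
    proof -
      have "d i \<in> {0..<2}" using d that by (auto simp: carrier_integer_mod_group PiE_iff)
      then show ?thesis by auto
    qed
    then have "(S * d i) mod M = S * d i" if "i < 4" for i
      using that S0 by (fastforce simp: M_eq)
    then have deg: "degree_a (v 0) = S * d 0" "degree_b (v 0) = S * d 2"
      "degree_a (v 1) = S * d 3" "degree_b (v 1) = S * d 1"
      by (simp_all add: v_def degree_mult degree_pow degree_generators)
    have "v \<in> carrier Z2_squared"
      using deg by (auto simp: v_def upper_central_2_eq split: if_splits)
    moreover have "digits v = d"
    proof (rule PiE_ext)
      show "digits v \<in> (\<Pi>\<^sub>E i\<in>{..<4}. carrier (integer_mod_group 2))"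
        using digits.hom_closed[OF \<open>v \<in> carrier Z2_squared\<close>] by simp
      show "d \<in> (\<Pi>\<^sub>E i\<in>{..<4}. carrier (integer_mod_group 2))" using d by simp
      show "digits v i = d i" if "i \<in> {..<4}" for i
        using that S0 deg by (auto simp: digits_def less_4_iff)
    qed
    ultimately show "d \<in> digits ` carrier Z2_squared" by blast
  qed
qed

lemma kernel_digits: "kernel Z2_squared bits digits = carrier Z1c_squared"
proof -
  have sub: "Z1c \<subseteq> Z2" unfolding center_times_c_eq by (auto simp: upper_central_2_eq)
  have "v \<in> kernel Z2_squared bits digits \<longleftrightarrow> v \<in> carrier Z1c_squared" for v
  proof -
    have "v \<in> kernel Z2_squared bits digits \<longleftrightarrow> v \<in> carrier Z2_squared \<and> v 0 \<in> Z1c \<and> v 1 \<in> Z1c"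
      unfolding kernel_def using Z2_squared_carrier[of v] digits_eq_one_iff[of v] by blast
    also have "\<dots> \<longleftrightarrow> v \<in> carrier Z1c_squared"
      using sub by (auto simp: PiE_iff less_2_cases_iff)
    finally show ?thesis .
  qed
  then show ?thesis by blast
qed

abbreviation "A2 \<equiv> (AutoGroup K)\<lparr>carrier := Aut2\<rparr>"

lemma Aut2_auto: "f \<in> Aut2 \<Longrightarrow> f \<in> auto K"
  by (simp add: Aut_ker_iff[OF normal_Z2])

lemma Aut2_displacement: "f \<in> Aut2 \<Longrightarrow> x \<in> carrier K \<Longrightarrow> f x \<otimes> inv x \<in> Z2"
proof -
  assume "f \<in> Aut2" and x: "x \<in> carrier K"
  then obtain z where z: "z \<in> Z2" "f x = z \<otimes> x" by (auto simp: Aut_ker_iff[OF normal_Z2])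
  then show ?thesis using x by (simp add: upper_central_2_eq m_assoc)
qed

lemma group_A2: "group A2"
  by (rule subgroup.subgroup_is_group[OF subgroup_Aut_ker[OF normal_Z2] AutoGroup])

text \<open>The matrix \<open>1 + S * X\<close> fixes all multiples of \<open>S\<close> modulo \<open>M\<close>, because \<open>M\<close> divides \<open>S * S\<close>.\<close>

lemma Aut2_degree:
  assumes f: "f \<in> Aut2" and u: "u \<in> Z2"
  shows "degree_a (f u) = degree_a u" "degree_b (f u) = degree_b u"
proof -
  interpret f: group_hom K K f
    by (intro group_hom.intro group_hom_axioms.intro group_axioms autoD(1) Aut2_auto f)
  have carr: "u \<in> carrier K" using u by (simp add: upper_central_2_eq)
  obtain i j k :: int where nf: "u = a [^] i \<otimes> b [^] j \<otimes> c [^] k" using normal_form[OF carr] by metis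
  have Sij: "S dvd i" "S dvd j" using u by (simp_all add: nf upper_central_2_eq degree_normal_form)
  obtain p q where p: "p \<in> Z2" "f a = p \<otimes> a" and q: "q \<in> Z2" "f b = q \<otimes> b"
    using f unfolding Aut_ker_iff[OF normal_Z2] by (meson a b)
  have pq: "p \<in> carrier K" "q \<in> carrier K" "S dvd degree_a p" "S dvd degree_b p" "S dvd degree_a q" "S dvd degree_b q"
    using p q by (simp_all add: upper_central_2_eq)
  have M0: "M dvd s * t" if "S dvd s" "S dvd t" for s t
    using mult_dvd_mono[OF that] even_S by (metis M_eq dvd_trans dvd_refl mult_dvd_mono)
  have fu: "f u = (p \<otimes> a) [^] i \<otimes> (q \<otimes> b) [^] j \<otimes> commutator K (p \<otimes> a) (q \<otimes> b) [^] k"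
    by (simp add: nf f.hom_int_pow f.hom_commutator p(2) q(2))
  have "degree_a (f u) = (i + (i * degree_a p + j * degree_a q)) mod M"
    using pq(1,2) by (simp add: fu degree_mult degree_pow degree_commutator degree_generators mod_simps)
       (simp add: algebra_simps)
  also have "\<dots> = i mod M"
    using M0[OF Sij(1) pq(3)] M0[OF Sij(2) pq(5)] by (simp add: mod_eq_dvd_iff)
  finally show "degree_a (f u) = degree_a u" by (simp add: nf degree_normal_form)
  have "degree_b (f u) = (j + (i * degree_b p + j * degree_b q)) mod M"
    using pq(1,2) by (simp add: fu degree_mult degree_pow degree_commutator degree_generators mod_simps)
       (simp add: algebra_simps)
  also have "\<dots> = j mod M"
    using M0[OF Sij(1) pq(4)] M0[OF Sij(2) pq(6)] by (simp add: mod_eq_dvd_iff)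
  finally show "degree_b (f u) = degree_b u" by (simp add: nf degree_normal_form)
qed

text \<open>In terms of matrices, \<open>(1 + S * X) * (1 + S * Y) = 1 + S * (X + Y)\<close> modulo \<open>M\<close>. In the group, the
  displacement of \<open>f \<circ> g\<close> at a generator \<open>t\<close> is the image under \<open>f\<close> of the displacement of \<open>g\<close>
  times the displacement of \<open>f\<close>.\<close>

lemma displacement_hom: "group_hom A2 bits (\<lambda>f. digits (displacement f))"
proof (intro group_hom.intro group_hom_axioms.intro group_A2 group_bits homI)
  fix f assume "f \<in> carrier A2"
  then show "digits (displacement f) \<in> carrier bits"
    using Aut2_displacement[of f] by (intro digits_in_bits) (simp_all add: displacement_def)
next
  fix f g assume "f \<in> carrier A2" "g \<in> carrier A2"
  then have fg: "f \<in> Aut2" "g \<in> Aut2" by simp_all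
  interpret f: group_hom K K f
    by (intro group_hom.intro group_hom_axioms.intro group_axioms autoD(1) Aut2_auto fg)
  have *: "f (g t) \<otimes> inv t \<in> Z2"
    "degree_a (f (g t) \<otimes> inv t) = degree_a ((f t \<otimes> inv t) \<otimes> (g t \<otimes> inv t))"
    "degree_b (f (g t) \<otimes> inv t) = degree_b ((f t \<otimes> inv t) \<otimes> (g t \<otimes> inv t))"
    if t: "t \<in> carrier K" for t
  proof -
    have gt: "g t \<in> carrier K" using autoD(4)[OF Aut2_auto[OF fg(2)] t] .
    let ?u = "g t \<otimes> inv t"
    have u: "?u \<in> Z2" by (rule Aut2_displacement[OF fg(2) t])
    have "f (g t) = f (?u \<otimes> t)" using t gt by (simp add: m_assoc del: f.hom_mult)
    also have "\<dots> = f ?u \<otimes> f t" using t gt by (intro f.hom_mult) auto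
    finally have eq: "f (g t) \<otimes> inv t = f ?u \<otimes> (f t \<otimes> inv t)" using t gt by (simp add: m_assoc)
    show da: "degree_a (f (g t) \<otimes> inv t) = degree_a ((f t \<otimes> inv t) \<otimes> (g t \<otimes> inv t))"
      unfolding eq using t gt Aut2_degree[OF fg(1) u] by (simp add: degree_mult add.commute del: f.hom_mult)
    show db: "degree_b (f (g t) \<otimes> inv t) = degree_b ((f t \<otimes> inv t) \<otimes> (g t \<otimes> inv t))"
      unfolding eq using t gt Aut2_degree[OF fg(1) u] by (simp add: degree_mult add.commute del: f.hom_mult)
    show "f (g t) \<otimes> inv t \<in> Z2"
      using upper_central_2_mult[OF Aut2_displacement[OF fg(1) t] u] da db t gt by (simp add: upper_central_2_eq)
  qed
  define w where "w = (\<lambda>i. displacement f i \<otimes> displacement g i)"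
  have "digits (displacement (f \<otimes>\<^bsub>A2\<^esub> g)) = digits w"
    using fg Aut2_auto *[of a] *[of b]
    by (simp add: digits_def displacement_def w_def mult_AutoGroup compose_def)
  also have "\<dots> = digits (displacement f) \<otimes>\<^bsub>bits\<^esub> digits (displacement g)"
    using fg Aut2_displacement by (intro digits_mult) (simp_all add: displacement_def w_def)
  finally show "digits (displacement (f \<otimes>\<^bsub>A2\<^esub> g)) = digits (displacement f) \<otimes>\<^bsub>bits\<^esub> digits (displacement g)" .
qed

lemma center_subset_Z1c: "group_center K \<subseteq> Z1c"
  unfolding center_times_c_eq group_center_eq by (auto simp: degree_mult degree_pow degree_generators)

lemma Z1c_subset_Z2: "Z1c \<subseteq> Z2"
  unfolding center_times_c_eq by (auto simp: upper_central_2_eq)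

lemma Aut1_iff: "f \<in> Aut1 \<longleftrightarrow> f \<in> auto K \<and> (\<forall>x\<in>carrier K. \<exists>z\<in>group_center K. f x = z \<otimes> x)"
  using Aut_ker_iff[of 1 f] normal_group_center unfolding One_nat_def upper_central_1 by blast

lemma kernel_displacement_iff:
  "f \<in> kernel A2 bits (\<lambda>f. digits (displacement f)) \<longleftrightarrow> f \<in> Aut2 \<and> f a \<otimes> inv a \<in> Z1c \<and> f b \<otimes> inv b \<in> Z1c"
proof -
  have "digits (displacement f) = \<one>\<^bsub>bits\<^esub> \<longleftrightarrow> f a \<otimes> inv a \<in> Z1c \<and> f b \<otimes> inv b \<in> Z1c" if "f \<in> Aut2"
    using digits_eq_one_iff[of "displacement f"] Aut2_displacement[OF that] by (simp add: displacement_def)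
  then show ?thesis by (auto simp: kernel_def)
qed

lemma Z1c_displacement_in_kernel:
  assumes "f \<in> auto K" "\<And>x. x \<in> carrier K \<Longrightarrow> f x \<otimes> inv x \<in> Z1c"
  shows "f \<in> kernel A2 bits (\<lambda>f. digits (displacement f))"
proof -
  have "\<exists>z\<in>Z2. f x = z \<otimes> x" if x: "x \<in> carrier K" for x
    using assms(2)[OF x] Z1c_subset_Z2 autoD(4)[OF assms(1) x] x
    by (intro bexI[of _ "f x \<otimes> inv x"]) (auto simp: m_assoc)
  then show ?thesis using assms by (simp add: kernel_displacement_iff Aut_ker_iff[OF normal_Z2])
qed

lemma Aut1_subset_kernel: "Aut1 \<subseteq> kernel A2 bits (\<lambda>f. digits (displacement f))"
proof
  fix f assume f: "f \<in> Aut1"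
  have "f x \<otimes> inv x \<in> Z1c" if x: "x \<in> carrier K" for x
  proof -
    obtain z where z: "z \<in> group_center K" "f x = z \<otimes> x" using f x unfolding Aut1_iff by blast
    then have "f x \<otimes> inv x = z" using x group_centerD(1)[OF z(1)] by (simp add: m_assoc)
    then show ?thesis using z(1) center_subset_Z1c by auto
  qed
  then show "f \<in> kernel A2 bits (\<lambda>f. digits (displacement f))"
    using f unfolding Aut1_iff by (intro Z1c_displacement_in_kernel) auto
qed

lemma Inn_subset_kernel: "Inn K \<subseteq> kernel A2 bits (\<lambda>f. digits (displacement f))"
proof
  fix f assume f: "f \<in> Inn K"
  then obtain g where g: "g \<in> carrier K" "f = (\<lambda>x\<in>carrier K. conjugate K x g)" by (auto simp: Inn_def)
  have "f x \<otimes> inv x \<in> Z1c" if x: "x \<in> carrier K" for x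
  proof -
    have eq: "f x \<otimes> inv x = commutator K g (inv x)"
      using g x by (simp add: commutator_def conjugate_def)
    show ?thesis unfolding eq center_times_c_eq using g(1) x by (simp add: degree_commutator)
  qed
  then show "f \<in> kernel A2 bits (\<lambda>f. digits (displacement f))"
    using f Inn_subset_auto by (intro Z1c_displacement_in_kernel) auto
qed

text \<open>Modulo its centre \<open>K\<close> has class two, so conjugation by a suitable \<open>g\<close> realizes any prescribed
  multiplication of \<open>a\<close> and \<open>b\<close> by powers of \<open>c\<close>, up to the centre.\<close>

lemma conjugation_mod_center:
  fixes k n :: int
  defines "g \<equiv> b [^] k \<otimes> a [^] (- n)"
  shows "\<exists>z\<in>group_center K. g \<otimes> (c [^] k \<otimes> a) = z \<otimes> (a \<otimes> g)"
    "\<exists>z\<in>group_center K. g \<otimes> (c [^] n \<otimes> b) = z \<otimes> (b \<otimes> g)"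
proof -
  let ?Z = "group_center K"
  interpret Z: normal ?Z K by (rule normal_group_center)
  interpret q: group_hom K "K Mod ?Z" "\<lambda>x. ?Z #> x"
    by (intro group_hom.intro group_hom_axioms.intro group_axioms Z.factorgroup_is_group Z.r_coset_hom_Mod)
  have central: "?Z #> (x \<otimes> y) = ?Z #> (y \<otimes> x)" if "x \<in> carrier K" "y \<in> carrier K" "x \<otimes> y = y \<otimes> x \<otimes> z" "z \<in> ?Z" for x y z
  proof -
    have "x \<otimes> y = z \<otimes> (y \<otimes> x)" using that group_centerD[of z] by simp
    with that(4) have "\<exists>z\<in>?Z. x \<otimes> y = z \<otimes> (y \<otimes> x)" by blast
    then show ?thesis using that(1,2) by (intro iffD2[OF Z.r_coset_eq_iff]) auto
  qed
  have ca: "?Z #> (inv c \<otimes> a) = ?Z #> (a \<otimes> inv c)"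
    by (rule central[where z = "a [^] (M * l)"])
       (use c_pow_a_pow[of "- 1" 1] a_pow_M_central in \<open>simp_all add: int_pow_neg\<close>)
  have cb: "?Z #> (inv c \<otimes> b) = ?Z #> (b \<otimes> inv c)"
    by (rule central[where z = "b [^] (M * - l)"])
       (use c_pow_b_pow[of "- 1" 1] b_pow_M_central[of "- l"] in \<open>simp_all add: int_pow_neg\<close>)
  let ?Q = "K Mod ?Z"
  have ba: "b \<otimes> a = a \<otimes> b \<otimes> inv c"
    by (simp add: commutator_def inv_mult_group m_assoc)
  note carr = a b commutator_closed[OF a b] inv_closed[OF commutator_closed[OF a b]]
  have "(?Z #> b) \<otimes>\<^bsub>?Q\<^esub> (?Z #> a) = (?Z #> a) \<otimes>\<^bsub>?Q\<^esub> (?Z #> b) \<otimes>\<^bsub>?Q\<^esub> (?Z #> inv c)"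
    "(?Z #> inv c) \<otimes>\<^bsub>?Q\<^esub> (?Z #> a) = (?Z #> a) \<otimes>\<^bsub>?Q\<^esub> (?Z #> inv c)"
    "(?Z #> inv c) \<otimes>\<^bsub>?Q\<^esub> (?Z #> b) = (?Z #> b) \<otimes>\<^bsub>?Q\<^esub> (?Z #> inv c)"
    by (simp_all only: q.hom_mult[symmetric] carr m_closed ba ca cb)
  note class2 = q.H.class2_conjugation[OF q.hom_closed[OF a] q.hom_closed[OF b] q.hom_closed[OF carr(4)] this]
  have pow: "?Z #> (x [^] i) = (?Z #> x) [^]\<^bsub>?Q\<^esub> i" if "x \<in> carrier K" for x and i :: int
    using q.hom_int_pow[OF that] .
  have inv_pow: "inv c [^] (- i) = c [^] i" for i :: int by (simp add: int_pow_inv int_pow_neg)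
  have "?Z #> (g \<otimes> (inv c [^] (- k) \<otimes> a)) = ?Z #> (a \<otimes> g)"
    unfolding g_def by (simp only: q.hom_mult pow carr m_closed int_pow_closed class2(1))
  then show "\<exists>z\<in>group_center K. g \<otimes> (c [^] k \<otimes> a) = z \<otimes> (a \<otimes> g)"
    unfolding inv_pow by (subst (asm) Z.r_coset_eq_iff) (simp_all add: g_def)
  have "?Z #> (g \<otimes> (inv c [^] (- n) \<otimes> b)) = ?Z #> (b \<otimes> g)"
    unfolding g_def by (simp only: q.hom_mult pow carr m_closed int_pow_closed class2(2))
  then show "\<exists>z\<in>group_center K. g \<otimes> (c [^] n \<otimes> b) = z \<otimes> (b \<otimes> g)"
    unfolding inv_pow by (subst (asm) Z.r_coset_eq_iff) (simp_all add: g_def)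
qed

text \<open>If the displacements of \<open>f\<close> lie in the commutator subgroup, then modulo the centre \<open>f\<close>
  multiplies \<open>a\<close> and \<open>b\<close> by powers of \<open>c\<close>. An inner automorphism does the same, and composing \<open>f\<close> with
  its inverse leaves an automorphism that is trivial modulo the centre.\<close>

lemma kernel_displacement:
  "kernel A2 bits (\<lambda>f. digits (displacement f)) = Inn K <#>\<^bsub>AutoGroup K\<^esub> Aut1"
proof
  interpret \<Psi>: group_hom A2 bits "\<lambda>f. digits (displacement f)" by (rule displacement_hom)
  let ?ker = "kernel A2 bits (\<lambda>f. digits (displacement f))"
  show "Inn K <#>\<^bsub>AutoGroup K\<^esub> Aut1 \<subseteq> ?ker"
    using subgroup.m_closed[OF \<Psi>.subgroup_kernel] Inn_subset_kernel Aut1_subset_kernel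
    by (auto simp: set_mult_def subset_iff)
  show "?ker \<subseteq> Inn K <#>\<^bsub>AutoGroup K\<^esub> Aut1"
  proof
    fix f assume "f \<in> ?ker"
    then have f: "f \<in> Aut2" and disp: "f a \<otimes> inv a \<in> Z1c" "f b \<otimes> inv b \<in> Z1c"
      by (simp_all add: kernel_displacement_iff)
    have fa: "f \<in> auto K" by (rule Aut2_auto[OF f])
    note f_carr = autoD(4)[OF fa]
    have Z1c: "\<exists>z\<in>group_center K. \<exists>k::int. f x = z \<otimes> (c [^] k \<otimes> x)"
      if disp: "f x \<otimes> inv x \<in> Z1c" and x: "x \<in> carrier K" for x
    proof -
      obtain z and k :: int where z: "z \<in> group_center K" "f x \<otimes> inv x = z \<otimes> c [^] k"
        using disp by (auto simp: set_mult_def generate_pow upper_central_1)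
      have "f x = f x \<otimes> inv x \<otimes> x" using x f_carr[OF x] by (simp add: m_assoc)
      then have "f x = z \<otimes> (c [^] k \<otimes> x)"
        unfolding z(2) using x group_centerD(1)[OF z(1)] by (simp add: m_assoc)
      then show ?thesis using z(1) by blast
    qed
    obtain z k where z: "z \<in> group_center K" "f a = z \<otimes> (c [^] (k :: int) \<otimes> a)" using Z1c[OF disp(1)] by auto
    obtain w n where w: "w \<in> group_center K" "f b = w \<otimes> (c [^] (n :: int) \<otimes> b)" using Z1c[OF disp(2)] by auto
    define g where "g = b [^] k \<otimes> a [^] (- n)"
    have g: "g \<in> carrier K" by (simp add: g_def)
    \<comment> \<open>Conjugation by \<open>g\<close> agrees with \<open>f\<close> on \<open>a\<close> and \<open>b\<close> up to the centre.\<close>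
    let ?\<theta> = "\<lambda>g. \<lambda>x\<in>carrier K. conjugate K x g"
    have inn: "?\<theta> x \<in> Inn K" if "x \<in> carrier K" for x using that by (auto simp: Inn_def)
    then have \<theta>a: "?\<theta> x \<in> auto K" if "x \<in> carrier K" for x using that Inn_subset_auto by blast
    define h where "h = ?\<theta> (inv g) \<otimes>\<^bsub>AutoGroup K\<^esub> f"
    interpret A: group "AutoGroup K" by (rule AutoGroup)
    have ha: "h \<in> auto K" using A.m_closed[of "?\<theta> (inv g)" f] \<theta>a g fa by (simp add: h_def)
    have hx: "h x = g \<otimes> f x \<otimes> inv g" if "x \<in> carrier K" for x
    proof -
      have "h x = conjugate K (f x) (inv g)"
        using that g f_carr by (simp add: h_def mult_AutoGroup[OF \<theta>a fa] compose_def)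
      then show ?thesis using g by (simp add: conjugate_def)
    qed
    have central: "\<exists>z'\<in>group_center K. h x = z' \<otimes> x"
      if x: "x \<in> carrier K" and z: "z \<in> group_center K" "f x = z \<otimes> (c [^] i \<otimes> x)"
        and ex: "\<exists>y\<in>group_center K. g \<otimes> (c [^] i \<otimes> x) = y \<otimes> (x \<otimes> g)" for x z and i :: int
    proof -
      obtain y where y: "y \<in> group_center K" "g \<otimes> (c [^] i \<otimes> x) = y \<otimes> (x \<otimes> g)" using ex by blast
      note zy = group_centerD(1)[OF z(1)] group_centerD(1)[OF y(1)]
      have "h x = g \<otimes> z \<otimes> (c [^] i \<otimes> x) \<otimes> inv g" using hx[OF x] x g zy by (simp add: z(2) m_assoc)
      also have "g \<otimes> z = z \<otimes> g" using group_centerD(2)[OF z(1) g] by simp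
      also have "z \<otimes> g \<otimes> (c [^] i \<otimes> x) \<otimes> inv g = z \<otimes> (g \<otimes> (c [^] i \<otimes> x)) \<otimes> inv g"
        using x g zy by (simp add: m_assoc)
      also have "\<dots> = (z \<otimes> y) \<otimes> x" unfolding y(2) using x g zy by (simp add: m_assoc)
      finally show ?thesis using subgroup.m_closed[OF subgroup_group_center z(1) y(1)] by blast
    qed
    obtain z' where z': "z' \<in> group_center K" "h a = z' \<otimes> a"
      using central[OF a z] conjugation_mod_center(1)[of k n] unfolding g_def by blast
    obtain w' where w': "w' \<in> group_center K" "h b = w' \<otimes> b"
      using central[OF b w] conjugation_mod_center(2)[of k n] unfolding g_def by blast
    have "h \<in> Aut1"
      unfolding Aut1_iff using ha hom_trivial_mod[OF normal_group_center autoD(1)[OF ha] z' w'] by blast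
    moreover have "f = ?\<theta> g \<otimes>\<^bsub>AutoGroup K\<^esub> h"
    proof (rule extensionalityI[of _ "carrier K"])
      show "f \<in> extensional (carrier K)" by (rule autoD(2)[OF fa])
      show "?\<theta> g \<otimes>\<^bsub>AutoGroup K\<^esub> h \<in> extensional (carrier K)"
        by (simp add: mult_AutoGroup[OF \<theta>a[OF g] ha])
      fix x assume x: "x \<in> carrier K"
      have "(?\<theta> g \<otimes>\<^bsub>AutoGroup K\<^esub> h) x = conjugate K (h x) g"
        using x autoD(4)[OF ha x] by (simp add: mult_AutoGroup[OF \<theta>a[OF g] ha] compose_def)
      then show "f x = (?\<theta> g \<otimes>\<^bsub>AutoGroup K\<^esub> h) x"
        using g f_carr[OF x] by (simp add: hx[OF x] conjugate_def m_assoc)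
    qed
    ultimately show "f \<in> Inn K <#>\<^bsub>AutoGroup K\<^esub> Aut1"
      using inn[OF g] by (auto simp: set_mult_def)
  qed
qed

lemma generating_automorphisms:
  obtains \<psi>1 \<psi>2 \<psi>3 \<psi>4 where
    "\<psi>1 \<in> Aut2" "\<psi>1 a = a [^] (1 + S)" "\<psi>1 b = b" "digits (displacement \<psi>1) = unit_vector 0"
    "\<psi>2 \<in> Aut2" "\<psi>2 a = a" "\<psi>2 b = b [^] (1 + S)" "digits (displacement \<psi>2) = unit_vector 1"
    "\<psi>3 \<in> Aut2" "\<psi>3 a = a \<otimes> b [^] S" "\<psi>3 b = b" "digits (displacement \<psi>3) = unit_vector 2"
    "\<psi>4 \<in> Aut2" "\<psi>4 a = a" "\<psi>4 b = b \<otimes> a [^] S" "digits (displacement \<psi>4) = unit_vector 3"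
proof -
  obtain \<psi>1 where 1: "\<psi>1 \<in> Aut2" "\<psi>1 a = a [^] (1 + S)" "\<psi>1 b = b" using Aut2_power by blast
  obtain \<psi>2 where 2: "\<psi>2 \<in> Aut2" "\<psi>2 a = a" "\<psi>2 b = b [^] (1 + S)"
    using macdonald_quotient.Aut2_power[OF mirror] by blast
  obtain \<psi>3 where 3: "\<psi>3 \<in> Aut2" "\<psi>3 a = a \<otimes> b [^] S" "\<psi>3 b = b" using Aut2_transvection by blast
  obtain \<psi>4 where 4: "\<psi>4 \<in> Aut2" "\<psi>4 a = a" "\<psi>4 b = b \<otimes> a [^] S"
    using macdonald_quotient.Aut2_transvection[OF mirror] by blast
  have S: "S > 0" "S mod M = S" by (simp_all add: S_def M_eq)
  have deg: "degree_a (a [^] (1 + S) \<otimes> inv a) = S" "degree_b (a [^] (1 + S) \<otimes> inv a) = 0"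
    "degree_a (b [^] (1 + S) \<otimes> inv b) = 0" "degree_b (b [^] (1 + S) \<otimes> inv b) = S"
    "degree_a (a \<otimes> b [^] S \<otimes> inv a) = 0" "degree_b (a \<otimes> b [^] S \<otimes> inv a) = S"
    "degree_a (b \<otimes> a [^] S \<otimes> inv b) = S" "degree_b (b \<otimes> a [^] S \<otimes> inv b) = 0"
    by (simp_all add: degree_mult degree_inv degree_pow degree_generators mod_simps S(2))
  have one: "degree_a \<one> = 0" "degree_b \<one> = 0"
    using degree_pow[of a 0] by simp_all
  have "digits (displacement \<psi>1) = unit_vector 0" "digits (displacement \<psi>2) = unit_vector 1"
    "digits (displacement \<psi>3) = unit_vector 2" "digits (displacement \<psi>4) = unit_vector 3"
    unfolding digits_def unit_vector_def displacement_def
    using 1 2 3 4 S(1) by (auto simp: less_4_iff deg one intro!: restrict_ext)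
  then show thesis using that 1 2 3 4 by blast
qed

theorem Aut2_quotient:
  "Inn K <#>\<^bsub>AutoGroup K\<^esub> Aut1 \<lhd> A2"
  "carrier Z1c_squared \<lhd> Z2_squared"
  "A2 Mod (Inn K <#>\<^bsub>AutoGroup K\<^esub> Aut1) \<cong> Z2_squared Mod carrier Z1c_squared"
  "Z2_squared Mod carrier Z1c_squared \<cong> bits"
  "\<exists>\<psi>1\<in>Aut2. \<exists>\<psi>2\<in>Aut2. \<exists>\<psi>3\<in>Aut2. \<exists>\<psi>4\<in>Aut2.
     \<psi>1 a = a [^] (1 + S) \<and> \<psi>1 b = b \<and> \<psi>2 a = a \<and> \<psi>2 b = b [^] (1 + S) \<and>
     \<psi>3 a = a \<otimes> b [^] S \<and> \<psi>3 b = b \<and> \<psi>4 a = a \<and> \<psi>4 b = b \<otimes> a [^] S \<and>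
     generate (A2 Mod (Inn K <#>\<^bsub>AutoGroup K\<^esub> Aut1))
       {(Inn K <#>\<^bsub>AutoGroup K\<^esub> Aut1) #>\<^bsub>A2\<^esub> \<psi>1, (Inn K <#>\<^bsub>AutoGroup K\<^esub> Aut1) #>\<^bsub>A2\<^esub> \<psi>2,
        (Inn K <#>\<^bsub>AutoGroup K\<^esub> Aut1) #>\<^bsub>A2\<^esub> \<psi>3, (Inn K <#>\<^bsub>AutoGroup K\<^esub> Aut1) #>\<^bsub>A2\<^esub> \<psi>4}
     = carrier (A2 Mod (Inn K <#>\<^bsub>AutoGroup K\<^esub> Aut1))"
proof -
  interpret \<Theta>: group_hom Z2_squared bits digits by (rule digits_hom)
  interpret \<Psi>: group_hom A2 bits "\<lambda>f. digits (displacement f)" by (rule displacement_hom)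
  note kernels = kernel_digits kernel_displacement
  show normal: "Inn K <#>\<^bsub>AutoGroup K\<^esub> Aut1 \<lhd> A2" "carrier Z1c_squared \<lhd> Z2_squared"
    using \<Theta>.normal_kernel \<Psi>.normal_kernel unfolding kernels by blast+
  show \<Theta>: "Z2_squared Mod carrier Z1c_squared \<cong> bits"
    using \<Theta>.FactGroup_iso[OF digits_surj] unfolding kernels .
  obtain \<psi>1 \<psi>2 \<psi>3 \<psi>4 where \<psi>:
    "\<psi>1 \<in> Aut2" "\<psi>1 a = a [^] (1 + S)" "\<psi>1 b = b" "digits (displacement \<psi>1) = unit_vector 0"
    "\<psi>2 \<in> Aut2" "\<psi>2 a = a" "\<psi>2 b = b [^] (1 + S)" "digits (displacement \<psi>2) = unit_vector 1"
    "\<psi>3 \<in> Aut2" "\<psi>3 a = a \<otimes> b [^] S" "\<psi>3 b = b" "digits (displacement \<psi>3) = unit_vector 2"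
    "\<psi>4 \<in> Aut2" "\<psi>4 a = a" "\<psi>4 b = b \<otimes> a [^] S" "digits (displacement \<psi>4) = unit_vector 3"
    by (rule generating_automorphisms)
  define \<psi> where "\<psi> i = [\<psi>1, \<psi>2, \<psi>3, \<psi>4] ! i" for i
  have image: "\<psi> ` {..<4} = {\<psi>1, \<psi>2, \<psi>3, \<psi>4}"
  proof -
    have "{..<4 :: nat} = {0, 1, 2, 3}" by (auto simp: less_4_iff)
    then show ?thesis by (simp add: \<psi>_def)
  qed
  have sub: "\<psi> ` {..<4} \<subseteq> carrier A2" unfolding image using \<psi> by simp
  have "digits (displacement (\<psi> i)) = unit_vector i" if "i < 4" for i
    using that \<psi> less_4_iff[of i] by (auto simp: \<psi>_def)
  then have onto: "\<exists>f\<in>generate A2 (\<psi> ` {..<4}). digits (displacement f) = d" if "d \<in> carrier bits" for d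
    using generate_unit_vectors[OF displacement_hom sub _ that] by blast
  have "(\<lambda>f. digits (displacement f)) ` carrier A2 = carrier bits"
    using onto \<Psi>.G.generate_incl[OF sub] \<Psi>.hom_closed by blast
  from \<Psi>.FactGroup_iso[OF this] have \<Psi>: "A2 Mod (Inn K <#>\<^bsub>AutoGroup K\<^esub> Aut1) \<cong> bits"
    unfolding kernels .
  show "A2 Mod (Inn K <#>\<^bsub>AutoGroup K\<^esub> Aut1) \<cong> Z2_squared Mod carrier Z1c_squared"
    using iso_trans[OF \<Psi> group.iso_sym[OF normal.factorgroup_is_group[OF normal(2)] \<Theta>]] .
  have "generate (A2 Mod (Inn K <#>\<^bsub>AutoGroup K\<^esub> Aut1))
      ((\<lambda>f. (Inn K <#>\<^bsub>AutoGroup K\<^esub> Aut1) #>\<^bsub>A2\<^esub> f) ` (\<psi> ` {..<4}))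
    = carrier (A2 Mod (Inn K <#>\<^bsub>AutoGroup K\<^esub> Aut1))"
    using \<Psi>.generate_FactGroup_kernel[OF sub onto] unfolding kernels .
  then show "\<exists>\<psi>1\<in>Aut2. \<exists>\<psi>2\<in>Aut2. \<exists>\<psi>3\<in>Aut2. \<exists>\<psi>4\<in>Aut2.
     \<psi>1 a = a [^] (1 + S) \<and> \<psi>1 b = b \<and> \<psi>2 a = a \<and> \<psi>2 b = b [^] (1 + S) \<and>
     \<psi>3 a = a \<otimes> b [^] S \<and> \<psi>3 b = b \<and> \<psi>4 a = a \<and> \<psi>4 b = b \<otimes> a [^] S \<and>
     generate (A2 Mod (Inn K <#>\<^bsub>AutoGroup K\<^esub> Aut1))
       {(Inn K <#>\<^bsub>AutoGroup K\<^esub> Aut1) #>\<^bsub>A2\<^esub> \<psi>1, (Inn K <#>\<^bsub>AutoGroup K\<^esub> Aut1) #>\<^bsub>A2\<^esub> \<psi>2,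
        (Inn K <#>\<^bsub>AutoGroup K\<^esub> Aut1) #>\<^bsub>A2\<^esub> \<psi>3, (Inn K <#>\<^bsub>AutoGroup K\<^esub> Aut1) #>\<^bsub>A2\<^esub> \<psi>4}
     = carrier (A2 Mod (Inn K <#>\<^bsub>AutoGroup K\<^esub> Aut1))"
    unfolding image using \<psi>
    by (intro bexI[of _ \<psi>1] bexI[of _ \<psi>2] bexI[of _ \<psi>3] bexI[of _ \<psi>4]) simp_all
qed

end

theorem proposition5p16:
  fixes m :: nat and l :: int
    and K :: "('k, 'e) monoid_scheme" and a b :: 'k
  assumes "m > 1" and "odd l"
    and "has_presentation K (case_gen a b) (K_relators m l)"
  shows "let c = commutator K a b;
             s = (2 ^ (m - 1) :: nat);
             A2 = (AutoGroup K)\<lparr>carrier := Aut_ker 2 K\<rparr>;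
             IA1 = Inn K <#>\<^bsub>AutoGroup K\<^esub> Aut_ker 1 K;
             Z2 = K\<lparr>carrier := upper_central K 2\<rparr>;
             Z1c = K\<lparr>carrier := upper_central K 1 <#>\<^bsub>K\<^esub> generate K {c}\<rparr>
         in
          IA1 \<lhd> A2 \<and>
          carrier (direct_power Z1c 2) \<lhd> direct_power Z2 2 \<and>
          A2 Mod IA1 \<cong> direct_power Z2 2 Mod carrier (direct_power Z1c 2) \<and>
          direct_power Z2 2 Mod carrier (direct_power Z1c 2) \<cong> direct_power (integer_mod_group 2) 4 \<and>
          (\<exists>\<psi>\<^sub>1 \<in> Aut_ker 2 K. \<exists>\<psi>\<^sub>2 \<in> Aut_ker 2 K. \<exists>\<psi>\<^sub>3 \<in> Aut_ker 2 K. \<exists>\<psi>\<^sub>4 \<in> Aut_ker 2 K.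
           \<psi>\<^sub>1 a = a [^]\<^bsub>K\<^esub> (1 + s) \<and> \<psi>\<^sub>1 b = b \<and>
           \<psi>\<^sub>2 a = a \<and> \<psi>\<^sub>2 b = b [^]\<^bsub>K\<^esub> (1 + s) \<and>
           \<psi>\<^sub>3 a = a \<otimes>\<^bsub>K\<^esub> b [^]\<^bsub>K\<^esub> s \<and> \<psi>\<^sub>3 b = b \<and>
           \<psi>\<^sub>4 a = a \<and> \<psi>\<^sub>4 b = b \<otimes>\<^bsub>K\<^esub> a [^]\<^bsub>K\<^esub> s \<and>
           generate (A2 Mod IA1)
             {IA1 #>\<^bsub>A2\<^esub> \<psi>\<^sub>1, IA1 #>\<^bsub>A2\<^esub> \<psi>\<^sub>2, IA1 #>\<^bsub>A2\<^esub> \<psi>\<^sub>3, IA1 #>\<^bsub>A2\<^esub> \<psi>\<^sub>4}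
           = carrier (A2 Mod IA1))"
proof -
  interpret group K using assms(3) by (simp add: has_presentation_def)
  interpret macdonald_quotient K m l a b
  proof (rule macdonald_quotient.intro[OF group_axioms], rule macdonald_quotient_axioms.intro)
    show "\<exists>f\<in>hom K K. f a = x \<and> f b = y"
      if "x \<in> carrier K" "y \<in> carrier K" "macdonald_relations K m l x y" for x y
      using K_extend[OF assms(3) group_axioms that] .
    show "\<exists>f\<in>hom K G. f a = x \<and> f b = y"
      if "group G" "x \<in> carrier G" "y \<in> carrier G" "macdonald_relations G m l x y"
      for G :: "(int \<Rightarrow> int) monoid" and x y
      using K_extend[OF assms(3) that] .
    show "\<exists>f\<in>hom K G. f a = x \<and> f b = y"
      if "group G" "x \<in> carrier G" "y \<in> carrier G" "macdonald_relations G m l x y"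
      for G :: "int monoid" and x y
      using K_extend[OF assms(3) that] .
  qed (rule assms(1,2) K_generated[OF assms(3)])+
  have pow: "x [^]\<^bsub>K\<^esub> (1 + S) = x [^]\<^bsub>K\<^esub> (1 + 2 ^ (m - 1) :: nat)" "x [^]\<^bsub>K\<^esub> S = x [^]\<^bsub>K\<^esub> (2 ^ (m - 1) :: nat)" for x
    using int_pow_int[of K x "1 + 2 ^ (m - 1)"] int_pow_int[of K x "2 ^ (m - 1)"] by (simp_all add: S_def)
  show ?thesis
    unfolding Let_def using Aut2_quotient unfolding pow One_nat_def[symmetric] by blast
qed

end
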